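(* Let $X$ be the Cantor space and let $\Gamma$ be an ample subgroup of $\mathrm{Homeo}(X)$ acting minimally on $X$. Let $K=K_1\sqcup\sigma(K_1)\subseteq X$, where $K_1$ is closed and $\sigma\in\mathrm{Homeo}(K)$ is an involution. Assume that $K$ is $\Gamma$-sparse. Denote by $R_{\Gamma,K}$ the finest equivalence relation on $X$ which is coarser than $R_\Gamma$ and for which $k$ and $\sigma(k)$ are equivalent for all $k\in K$. Then there exists $f\in\mathrm{Homeo}(X)$ such that $f\Gamma f^{-1}$ induces $R_{\Gamma,K}$ (hence $R_{\Gamma,K}$ and $R_\Gamma$ are isomorphic).
   Context: $\mathrm{Homeo}(X)$ is the group of homeomorphisms of $X$. A subgroup $\Gamma\le\mathrm{Homeo}(X)$ is a full group if it contains every $g\in\mathrm{Homeo}(X)$ for which there is a finite $A\subset\Gamma$ such that for all $x\in X$ there is $\gamma\in A$ with $g(x)=\gamma(x)$. $\Gamma$ is ample if it is a countable, locally finite, full group such that $\{x\in X\colon\gamma(x)=x\}$ is clopen for every $\gamma\in\Gamma$. It acts minimally if all its orbits in $X$ are dense. $R_\Gamma$ is the orbit equivalence relation of $\Gamma$ on $X$: $xR_\Gamma y$ iff $\gamma(x)=y$ for some $\gamma\in\Gamma$; a group $\Sigma\le\mathrm{Homeo}(X)$ induces a relation $R$ if $R=R_\Sigma$. A closed set $K\subseteq X$ is $\Gamma$-sparse if each $\Gamma$-orbit intersects $K$ in at most one point. $\sqcup$ denotes disjoint union. Two equivalence relations $R,S$ on $X$ are isomorphic if there is $g\in\mathrm{Homeo}(X)$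 such that for all $x,x'$: $xRx'$ iff $g(x)Sg(x')$. *)

theory Defs
  imports "HOL-Analysis.Analysis" "HOL-Algebra.Generated_Groups"
begin

text \<open>The Cantor space \<open>2\<^sup>\<omega>\<close>: \<^typ>\<open>bool\<close> is discrete, and function types carry the
  product topology.\<close>

type_synonym cantor = "nat \<Rightarrow> bool"

text \<open>A member of \<open>homeos S\<close> is only constrained on \<open>S\<close>; for \<open>S = UNIV\<close> this is exactly
  the set of self-homeomorphisms of the space.\<close>

definition homeos :: "'a::topological_space set \<Rightarrow> ('a \<Rightarrow> 'a) set" where
  "homeos S = {f. \<exists>g. homeomorphism S S f g}"

definition Homeo :: "('a::topological_space \<Rightarrow> 'a) monoid" where
  "Homeo = \<lparr>carrier = homeos UNIV, mult = (\<circ>), one = id\<rparr>"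

lemma homeos_id: "id \<in> homeos S"
  unfolding homeos_def id_def using homeomorphism_ident by blast

lemma group_Homeo: "group Homeo"
proof (rule groupI)
  fix f g :: "'a \<Rightarrow> 'a"
  assume "f \<in> carrier Homeo" "g \<in> carrier Homeo"
  then obtain f' g' where "homeomorphism UNIV UNIV f f'" "homeomorphism UNIV UNIV g g'"
    by (auto simp: Homeo_def homeos_def)
  then have "homeomorphism UNIV UNIV (f \<circ> g) (g' \<circ> f')"
    by (rule homeomorphism_compose[rotated])
  then show "f \<otimes>\<^bsub>Homeo\<^esub> g \<in> carrier Homeo"
    by (auto simp: Homeo_def homeos_def)
next
  fix f :: "'a \<Rightarrow> 'a"
  assume "f \<in> carrier Homeo"
  then obtain g where g: "homeomorphism UNIV UNIV f g"
    by (auto simp: Homeo_def homeos_def)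
  then have "g \<circ> f = id"
    by (simp add: homeomorphism_def fun_eq_iff)
  moreover have "g \<in> homeos UNIV"
    using g homeomorphism_symD unfolding homeos_def by blast
  ultimately show "\<exists>g\<in>carrier Homeo. g \<otimes>\<^bsub>Homeo\<^esub> f = \<one>\<^bsub>Homeo\<^esub>"
    by (auto simp: Homeo_def)
qed (auto simp: Homeo_def homeos_id)

definition orbit_rel :: "('a \<Rightarrow> 'a) set \<Rightarrow> ('a \<times> 'a) set" where
  "orbit_rel \<Gamma> = {(x, y). \<exists>\<gamma>\<in>\<Gamma>. \<gamma> x = y}"

definition full_group :: "('a::topological_space \<Rightarrow> 'a) set \<Rightarrow> bool" where
  "full_group \<Gamma> \<longleftrightarrow> subgroup \<Gamma> Homeo \<and>
     (\<forall>g\<in>carrier Homeo. (\<exists>A\<subseteq>\<Gamma>. finite A \<and> (\<forall>x. \<exists>\<gamma>\<in>A. g x = \<gamma> x)) \<longrightarrow> g \<in> \<Gamma>)"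

text \<open>Locally finite: every finitely generated subgroup is finite.\<close>

definition locally_finite_group :: "('a::topological_space \<Rightarrow> 'a) set \<Rightarrow> bool" where
  "locally_finite_group \<Gamma> \<longleftrightarrow> (\<forall>A\<subseteq>\<Gamma>. finite A \<longrightarrow> finite (generate Homeo A))"

definition ample :: "('a::topological_space \<Rightarrow> 'a) set \<Rightarrow> bool" where
  "ample \<Gamma> \<longleftrightarrow> full_group \<Gamma> \<and> countable \<Gamma> \<and> locally_finite_group \<Gamma> \<and>
     (\<forall>\<gamma>\<in>\<Gamma>. open {x. \<gamma> x = x} \<and> closed {x. \<gamma> x = x})"

definition minimal_action :: "('a::topological_space \<Rightarrow> 'a) set \<Rightarrow> bool" where
  "minimal_action \<Gamma> \<longleftrightarrow> (\<forall>x. closure ((\<lambda>\<gamma>. \<gamma> x) ` \<Gamma>) = UNIV)"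

definition sparse :: "('a::topological_space \<Rightarrow> 'a) set \<Rightarrow> 'a set \<Rightarrow> bool" where
  "sparse \<Gamma> K \<longleftrightarrow> closed K \<and>
     (\<forall>x. \<forall>y \<in> K \<inter> (\<lambda>\<gamma>. \<gamma> x) ` \<Gamma>. \<forall>z \<in> K \<inter> (\<lambda>\<gamma>. \<gamma> x) ` \<Gamma>. y = z)"

definition induces :: "('a::topological_space \<Rightarrow> 'a) set \<Rightarrow> ('a \<times> 'a) set \<Rightarrow> bool" where
  "induces \<Sigma> R \<longleftrightarrow> subgroup \<Sigma> Homeo \<and> R = orbit_rel \<Sigma>"

definition rel_isomorphic :: "('a::topological_space \<times> 'a) set \<Rightarrow> ('a \<times> 'a) set \<Rightarrow> bool" where
  "rel_isomorphic R S \<longleftrightarrow> (\<exists>g\<in>carrier Homeo. \<forall>x x'. (x, x') \<in> R \<longleftrightarrow> (g x, g x') \<in> S)"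

text \<open>The finest equivalence relation containing \<open>R\<^sub>\<Gamma>\<close> and all pairs \<open>(k, \<sigma> k)\<close>, as the
  intersection of all such equivalence relations.\<close>

definition glued_rel :: "('a \<Rightarrow> 'a) set \<Rightarrow> 'a set \<Rightarrow> ('a \<Rightarrow> 'a) \<Rightarrow> ('a \<times> 'a) set" where
  "glued_rel \<Gamma> K \<sigma> =
     \<Inter>{E. equiv UNIV E \<and> orbit_rel \<Gamma> \<subseteq> E \<and> (\<forall>k\<in>K. (k, \<sigma> k) \<in> E)}"

lemma equiv_glued_rel: "equiv UNIV (glued_rel \<Gamma> K \<sigma>)"
  unfolding glued_rel_def
proof (rule equivI)
  let ?F = "{E. equiv UNIV E \<and> orbit_rel \<Gamma> \<subseteq> E \<and> (\<forall>k\<in>K. (k, \<sigma> k) \<in> E)}"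
  show "\<Inter>?F \<subseteq> UNIV \<times> UNIV" by simp
  show "refl_on UNIV (\<Inter>?F)"
    by (rule refl_onI) (fastforce elim: equivE dest: refl_onD)
  show "sym (\<Inter>?F)"
    by (rule symI) (fastforce elim: equivE dest: symD)
  show "trans (\<Inter>?F)"
  proof (rule transI, rule InterI)
    fix x y z E
    assume "(x, y) \<in> \<Inter>?F" "(y, z) \<in> \<Inter>?F" and E: "E \<in> ?F"
    then have "(x, y) \<in> E" "(y, z) \<in> E" by blast+
    moreover have "trans E" using E by (simp add: equiv_def)
    ultimately show "(x, z) \<in> E" by (blast dest: transD)
  qed
qed

end

theory Submission
  imports Defs
begin

text \<open>
  Write \<open>\<Gamma>\<close> as an increasing union of finite groups \<open>\<Gamma>\<^sub>n\<close> and cut every orbit \<open>\<Gamma> k\<close> with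
  \<open>k \<in> K\<^sub>1\<close> into infinitely many pieces, each of them a union of shells \<open>\<Gamma>\<^sub>n k - \<Gamma>\<^sub>n\<^sub>-\<^sub>1 k\<close>. The elements
  of \<open>\<Gamma>\<close> respecting the pieces form a smaller ample group \<open>\<Lambda>\<close> which still acts minimally and has
  the pieces as orbits. Choose continuous sections \<open>\<psi>\<^sub>i\<close> on \<open>K\<^sub>1\<close> with \<open>\<psi>\<^sub>0 = id\<close>, with
  \<open>\<psi>\<^sub>i k\<close> in the \<open>i\<close>-th piece of \<open>\<Gamma> k\<close>, and with \<open>\<psi>\<^sub>i \<longlonglongrightarrow> id\<close> uniformly. Then \<open>L = \<Union>\<^sub>i \<psi>\<^sub>i K\<^sub>1\<close> and
  \<open>L \<union> \<sigma> K\<^sub>1\<close> are \<open>\<Lambda>\<close>-sparse, and the Hilbert hotel shift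
  \<open>\<psi>\<^sub>0 k \<mapsto> \<psi>\<^sub>0 k\<close>, \<open>\<psi>\<^sub>1 k \<mapsto> \<sigma> k\<close>, \<open>\<psi>\<^sub>i\<^sub>+\<^sub>1 k \<mapsto> \<psi>\<^sub>i k\<close> is a homeomorphism between them. It extends
  to a homeomorphism \<open>f\<close> normalizing \<open>\<Lambda>\<close>. Since \<open>R\<^sub>\<Gamma>\<close> is \<open>R\<^sub>\<Lambda>\<close> with the pieces of each \<open>\<Gamma> k\<close>
  joined, and \<open>R\<^sub>\<Gamma>\<^sub>,\<^sub>K\<close> in addition joins \<open>\<Gamma> (\<sigma> k)\<close> to them, \<open>f\<close> carries \<open>R\<^sub>\<Gamma>\<close> to \<open>R\<^sub>\<Gamma>\<^sub>,\<^sub>K\<close>.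

  The extension \<open>f\<close> is a limit of elements of \<open>\<Lambda>\<close>, each obtained from the preceding one by an
  involution commuting with a finite subgroup; as these subgroups exhaust \<open>\<Lambda>\<close>, the limit
  normalizes \<open>\<Lambda>\<close>.
\<close>

section \<open>The topology of the Cantor space\<close>

text \<open>Cylinders of length \<open>n\<close>; they take the place of balls in a metric.\<close>

definition agree :: "nat \<Rightarrow> cantor \<Rightarrow> cantor \<Rightarrow> bool" where
  "agree n x y \<longleftrightarrow> (\<forall>i<n. x i = y i)"

lemma agree_refl [simp]: "agree n x x"
  by (simp add: agree_def)

lemma agree_sym: "agree n x y \<Longrightarrow> agree n y x"
  by (simp add: agree_def)

lemma agree_trans: "agree n x y \<Longrightarrow> agree n y z \<Longrightarrow> agree n x z"
  by (simp add: agree_def)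

lemma agree_mono: "agree n x y \<Longrightarrow> m \<le> n \<Longrightarrow> agree m x y"
  by (simp add: agree_def)

lemma agree_all_eq: "(\<And>n. agree n x y) \<Longrightarrow> x = y"
  unfolding agree_def by blast

lemma open_agree: "open {y. agree n x y}"
proof -
  have "open ((\<lambda>y::cantor. y i) -` {x i})" for i
    by (rule open_vimage) (auto simp: open_discrete)
  then have "open (\<Inter>i\<in>{..<n}. (\<lambda>y::cantor. y i) -` {x i})"
    by (intro open_INT) auto
  also have "(\<Inter>i\<in>{..<n}. (\<lambda>y::cantor. y i) -` {x i}) = {y. agree n x y}"
    by (auto simp: agree_def)
  finally show ?thesis .
qed

lemma open_agree_subset:
  fixes U :: "cantor set"
  assumes "open U" "x \<in> U"
  obtains n where "\<And>y. agree n x y \<Longrightarrow> y \<in> U"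
proof -
  have "openin (product_topology (\<lambda>i::nat. euclidean :: bool topology) UNIV) U"
    using assms(1) by (simp add: open_fun_def)
  from product_topology_open_contains_basis[OF this assms(2)]
  obtain X where X: "x \<in> (\<Pi>\<^sub>E i\<in>UNIV. X i)" "finite {i. X i \<noteq> UNIV}" "(\<Pi>\<^sub>E i\<in>UNIV. X i) \<subseteq> U"
    by auto
  obtain n where n: "\<And>i. X i \<noteq> UNIV \<Longrightarrow> i < n"
    using X(2) finite_nat_set_iff_bounded by auto
  have "y \<in> U" if "agree n x y" for y
  proof -
    have "y i \<in> X i" for i
    proof (cases "X i = UNIV")
      case False
      then have "y i = x i" using n that by (auto simp: agree_def)
      then show ?thesis using X(1) by auto
    qed auto
    then show ?thesis using X(3) by auto
  qed
  then show thesis by (rule that)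
qed

text \<open>Cylinders form a neighbourhood base. Local statements are phrased with
  \<open>nhds\<close> throughout and become statements about a single cylinder here.\<close>

lemma eventually_nhds_cantor:
  fixes x :: cantor
  shows "eventually P (nhds x) \<longleftrightarrow> (\<exists>n. \<forall>y. agree n x y \<longrightarrow> P y)" (is "?l \<longleftrightarrow> ?r")
proof
  assume ?l
  then obtain U where "open U" "x \<in> U" "\<forall>y\<in>U. P y" by (auto simp: eventually_nhds)
  then show ?r using open_agree_subset[of U x] by metis
next
  assume ?r
  then obtain n where "\<forall>y. agree n x y \<longrightarrow> P y" ..
  then show ?l unfolding eventually_nhds using open_agree[of n x]
    by (intro exI[of _ "{y. agree n x y}"]) auto
qed

lemma eventually_agree: "eventually (agree n x) (nhds x)"
  by (auto simp: eventually_nhds_cantor)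

lemma open_iff_eventually: "open U \<longleftrightarrow> (\<forall>x\<in>U. eventually (\<lambda>y. y \<in> U) (nhds x))"
  unfolding open_subopen[of U] eventually_nhds subset_iff Ball_def by simp

lemma eventually_self: "eventually P (nhds x) \<Longrightarrow> P x"
  by (auto simp: eventually_nhds)

lemma eventually_comp:
  assumes "continuous_on UNIV g" "eventually P (nhds (g x))"
  shows "eventually (\<lambda>y. P (g y)) (nhds x)"
proof -
  obtain U where U: "open U" "g x \<in> U" "\<forall>y\<in>U. P y" using assms(2) by (auto simp: eventually_nhds)
  then have "open (g -` U)" using assms(1) by (simp add: open_vimage)
  then show ?thesis unfolding eventually_nhds using U by (intro exI[of _ "g -` U"]) auto
qed

lemma continuous_iff_agree:
  fixes f :: "cantor \<Rightarrow> cantor"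
  shows "continuous_on UNIV f \<longleftrightarrow> (\<forall>x n. eventually (\<lambda>y. agree n (f x) (f y)) (nhds x))"
proof
  assume "continuous_on UNIV f"
  then show "\<forall>x n. eventually (\<lambda>y. agree n (f x) (f y)) (nhds x)"
    using eventually_comp[of f "agree n (f x)" for n x] eventually_agree by blast
next
  assume *: "\<forall>x n. eventually (\<lambda>y. agree n (f x) (f y)) (nhds x)"
  have "open (f -` U)" if U: "open U" for U
    unfolding open_iff_eventually
  proof
    fix x assume "x \<in> f -` U"
    then obtain n where "\<And>y. agree n (f x) y \<Longrightarrow> y \<in> U" using open_agree_subset[OF U] by auto
    then show "eventually (\<lambda>y. y \<in> f -` U) (nhds x)"
      using *[rule_format, of n x] by (auto elim: eventually_mono)
  qed
  then show "continuous_on UNIV f" by (simp add: continuous_on_open_vimage)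
qed

lemma eventually_neq:
  fixes f g :: "'a::topological_space \<Rightarrow> cantor"
  assumes "continuous_on UNIV f" "continuous_on UNIV g" "f x \<noteq> g x"
  shows "eventually (\<lambda>y. f y \<noteq> g y) (nhds x)"
proof -
  obtain i where i: "f x i \<noteq> g x i" using assms(3) by auto
  have "eventually (\<lambda>y. agree (Suc i) (f x) (f y)) (nhds x)"
    "eventually (\<lambda>y. agree (Suc i) (g x) (g y)) (nhds x)"
    using eventually_comp[OF assms(1)] eventually_comp[OF assms(2)] eventually_agree by blast+
  then show ?thesis
    by eventually_elim (use i in \<open>auto simp: agree_def\<close>)
qed

section \<open>Compactness and neighbourhoods of closed sets\<close>

lemma compact_cantor: "compact (UNIV :: cantor set)"
proof -
  have "compact_space (euclidean :: bool topology)"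
    by (simp add: compact_space_def compactin_euclidean_iff finite_imp_compact)
  then have "compact_space (product_topology (\<lambda>i::nat. euclidean :: bool topology) UNIV)"
    by (simp add: compact_space_product_topology)
  then show ?thesis
    by (simp add: euclidean_product_topology compact_space_def compactin_euclidean_iff)
qed

lemma compact_closed_cantor: "closed K \<Longrightarrow> compact (K :: cantor set)"
  using closed_Int_compact[OF _ compact_cantor] by auto

text \<open>The form in which compactness is used: the interiors \<open>U n\<close> of the sets
  where \<open>P n\<close> holds cover \<open>K\<close>, finitely many suffice, and by monotonicity
  the largest index serves everywhere.\<close>

lemma compact_uniform:
  assumes "compact K" and loc: "\<And>x. x \<in> K \<Longrightarrow> \<exists>n::nat. eventually (P n) (nhds x)"
    and mono: "\<And>m n x. m \<le> n \<Longrightarrow> P m x \<Longrightarrow> P n x"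
  shows "\<exists>n. \<forall>x\<in>K. P n x"
proof -
  define U where "U n = \<Union>{V. open V \<and> (\<forall>y\<in>V. P n y)}" for n
  have "open (U n)" for n unfolding U_def by auto
  moreover have "K \<subseteq> (\<Union>n\<in>UNIV. U n)"
  proof
    fix x assume "x \<in> K"
    then obtain n V where "open V" "x \<in> V" "\<forall>y\<in>V. P n y"
      using loc unfolding eventually_nhds by meson
    then have "x \<in> U n" unfolding U_def by blast
    then show "x \<in> (\<Union>n\<in>UNIV. U n)" by blast
  qed
  ultimately obtain F where F: "finite F" "K \<subseteq> (\<Union>n\<in>F. U n)"
    using compactE_image[OF assms(1), of UNIV U] by auto
  have "P (Max F) x" if xK: "x \<in> K" for x
  proof -
    obtain n where "n \<in> F" "x \<in> U n" using F(2) xK by auto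
    then show ?thesis using mono[of n "Max F" x] F(1) unfolding U_def by auto
  qed
  then show ?thesis by blast
qed

lemma closed_not_eventually:
  assumes "closed L" "x \<notin> L"
  shows "eventually (\<lambda>y. y \<notin> L) (nhds x)"
  using assms unfolding eventually_nhds closed_def by (intro exI[of _ "- L"]) auto

lemma closed_cantor:
  fixes L :: "cantor set"
  assumes "\<And>x. x \<notin> L \<Longrightarrow> eventually (\<lambda>y. y \<notin> L) (nhds x)"
  shows "closed L"
  unfolding closed_def open_iff_eventually using assms by auto

text \<open>Perfectness of the Cantor space. It lets minimality produce orbit points that differ
  from finitely many given ones.\<close>

lemma avoid_finite:
  fixes x :: cantor
  assumes "finite F"
  obtains m z where "agree n x z" "\<And>y. agree m z y \<Longrightarrow> y \<notin> F \<and> agree n x y"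
proof -
  \<comment> \<open>infinitely many points near \<open>x\<close>, each changing one late coordinate\<close>
  define q where "q i = x(n + i := \<not> x (n + i))" for i
  have inj: "inj q"
  proof (rule injI)
    fix i j assume "q i = q j"
    from fun_cong[OF this, of "n + i"] show "i = j" by (auto simp: q_def split: if_splits)
  qed
  have "\<not> range q \<subseteq> F" using inj assms finite_subset range_inj_infinite by blast
  then obtain i where i: "q i \<notin> F" by auto
  have ev: "eventually (\<lambda>y. y \<notin> F \<and> agree n x y) (nhds (q i))"
  proof (rule eventually_conj)
    have "eventually (\<lambda>y. \<forall>z\<in>F. y \<noteq> z) (nhds (q i))"
      using i by (intro eventually_ball_finite assms ballI eventually_neq) auto
    then show "eventually (\<lambda>y. y \<notin> F) (nhds (q i))" by (rule eventually_mono) auto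
    have "agree n x (q i)" by (simp add: agree_def q_def)
    then show "eventually (\<lambda>y. agree n x y) (nhds (q i))"
      using eventually_agree[of n "q i"] by (auto elim: eventually_mono intro: agree_trans)
  qed
  then obtain m where "\<forall>y. agree m (q i) y \<longrightarrow> y \<notin> F \<and> agree n x y"
    by (auto simp: eventually_nhds_cantor)
  then show thesis using that[of "q i" m] by auto
qed

lemma continuous_on_iff_agree:
  fixes f :: "cantor \<Rightarrow> cantor"
  shows "continuous_on L f \<longleftrightarrow>
    (\<forall>x\<in>L. \<forall>n. eventually (\<lambda>y. y \<in> L \<longrightarrow> agree n (f x) (f y)) (nhds x))"
proof
  assume *: "continuous_on L f"
  show "\<forall>x\<in>L. \<forall>n. eventually (\<lambda>y. y \<in> L \<longrightarrow> agree n (f x) (f y)) (nhds x)"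
  proof (intro ballI allI)
    fix x n assume x: "x \<in> L"
    then have "(f \<longlongrightarrow> f x) (at x within L)" using * by (simp add: continuous_on)
    from topological_tendstoD[OF this open_agree[of n "f x"]]
    have "eventually (\<lambda>y. agree n (f x) (f y)) (at x within L)" by simp
    then show "eventually (\<lambda>y. y \<in> L \<longrightarrow> agree n (f x) (f y)) (nhds x)"
      unfolding eventually_at_filter by (rule eventually_mono) (metis agree_refl)
  qed
next
  assume *: "\<forall>x\<in>L. \<forall>n. eventually (\<lambda>y. y \<in> L \<longrightarrow> agree n (f x) (f y)) (nhds x)"
  show "continuous_on L f"
    unfolding continuous_on
  proof (intro ballI topological_tendstoI)
    fix x U assume x: "x \<in> L" and U: "open U" "f x \<in> U"
    obtain n where n: "\<And>y. agree n (f x) y \<Longrightarrow> y \<in> U" using open_agree_subset[OF U] by blast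
    have "eventually (\<lambda>y. y \<in> L \<longrightarrow> agree n (f x) (f y)) (nhds x)" using * x by blast
    then show "eventually (\<lambda>y. f y \<in> U) (at x within L)"
      unfolding eventually_at_filter by (rule eventually_mono) (use n in blast)
  qed
qed

text \<open>Clopen neighbourhoods of \<open>L\<close>, shrinking to \<open>L\<close> as
  \<open>n\<close> grows when \<open>L\<close> is closed.\<close>

definition nbhd :: "nat \<Rightarrow> cantor set \<Rightarrow> cantor set" where
  "nbhd n L = {x. \<exists>y\<in>L. agree n y x}"

lemma nbhd_mono: "m \<le> n \<Longrightarrow> nbhd n L \<subseteq> nbhd m L"
  unfolding nbhd_def using agree_mono by blast

lemma subset_nbhd: "L \<subseteq> nbhd n L"
  unfolding nbhd_def using agree_refl by blast

lemma nbhd_agree: "x \<in> nbhd n L \<Longrightarrow> agree n x y \<Longrightarrow> y \<in> nbhd n L"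
  unfolding nbhd_def using agree_trans by blast

lemma eventually_nbhd: "x \<in> nbhd n L \<Longrightarrow> eventually (\<lambda>y. y \<in> nbhd n L) (nhds x)"
  using eventually_agree[of n x] nbhd_agree by (blast intro: eventually_mono)

lemma closed_nbhd: "closed (nbhd n L)"
proof (rule closed_cantor)
  fix x assume x: "x \<notin> nbhd n L"
  show "eventually (\<lambda>y. y \<notin> nbhd n L) (nhds x)"
    using eventually_agree[of n x] by (rule eventually_mono) (use x nbhd_agree agree_sym in blast)
qed

lemma eventually_not_nbhd:
  assumes "closed L" "x \<notin> L"
  obtains n where "eventually (\<lambda>y. y \<notin> nbhd n L) (nhds x)"
proof -
  obtain n where n: "\<And>y. agree n x y \<Longrightarrow> y \<notin> L"
    using closed_not_eventually[OF assms] by (auto simp: eventually_nhds_cantor)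
  have "y \<notin> nbhd n L" if "agree n x y" for y
    using n agree_trans[OF that] agree_sym unfolding nbhd_def by blast
  then have "eventually (\<lambda>y. y \<notin> nbhd n L) (nhds x)"
    by (rule eventually_mono[OF eventually_agree])
  then show thesis by (rule that)
qed

text \<open>Compactness of the product: a pair in \<open>L \<times> L\<close> has a neighbourhood
  inside \<open>Q\<close>, and for any other pair one coordinate stays out of some
  \<open>nbhd n L\<close>, so the claim is vacuous near it.\<close>

lemma nbhd_pairs:
  fixes Q :: "cantor \<Rightarrow> cantor \<Rightarrow> bool"
  assumes "closed L" and Q: "\<And>x y. x \<in> L \<Longrightarrow> y \<in> L \<Longrightarrow> Q x y"
    and op: "\<And>x y. Q x y \<Longrightarrow> eventually (\<lambda>z. Q (fst z) (snd z)) (nhds (x, y))"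
  shows "\<exists>n. \<forall>x\<in>nbhd n L. \<forall>y\<in>nbhd n L. Q x y"
proof -
  have cp: "compact (UNIV \<times> UNIV :: (cantor \<times> cantor) set)"
    by (intro compact_Times compact_cantor)
  have "\<exists>n. \<forall>z\<in>UNIV \<times> UNIV. fst z \<in> nbhd n L \<longrightarrow> snd z \<in> nbhd n L \<longrightarrow> Q (fst z) (snd z)"
  proof (rule compact_uniform[OF cp])
    fix z :: "cantor \<times> cantor"
    obtain x y where z: "z = (x, y)" by fastforce
    consider "x \<in> L" "y \<in> L" | "x \<notin> L" | "y \<notin> L" by blast
    then show "\<exists>n. eventually (\<lambda>z. fst z \<in> nbhd n L \<longrightarrow> snd z \<in> nbhd n L \<longrightarrow> Q (fst z) (snd z)) (nhds z)"
    proof cases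
      case 1
      have "eventually (\<lambda>z. Q (fst z) (snd z)) (nhds (x, y))" using Q op 1 by blast
      then show ?thesis unfolding z by (intro exI) (erule eventually_mono, auto)
    next
      case 2
      obtain n where n: "eventually (\<lambda>y. y \<notin> nbhd n L) (nhds x)"
        using eventually_not_nbhd[OF assms(1) 2] .
      have "eventually (\<lambda>z. fst z \<notin> nbhd n L) (nhds z)"
        by (rule eventually_comp[of fst "\<lambda>x. x \<notin> nbhd n L"])
          (simp_all add: z n continuous_on_fst)
      then show ?thesis by (intro exI[of _ n]) (erule eventually_mono, blast)
    next
      case 3
      obtain n where n: "eventually (\<lambda>y. y \<notin> nbhd n L) (nhds y)"
        using eventually_not_nbhd[OF assms(1) 3] .
      have "eventually (\<lambda>z. snd z \<notin> nbhd n L) (nhds z)"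
        by (rule eventually_comp[of snd "\<lambda>x. x \<notin> nbhd n L"])
          (simp_all add: z n continuous_on_snd)
      then show ?thesis by (intro exI[of _ n]) (erule eventually_mono, blast)
    qed
  next
    fix m n :: nat and z :: "cantor \<times> cantor"
    assume "m \<le> n" "fst z \<in> nbhd m L \<longrightarrow> snd z \<in> nbhd m L \<longrightarrow> Q (fst z) (snd z)"
    then show "fst z \<in> nbhd n L \<longrightarrow> snd z \<in> nbhd n L \<longrightarrow> Q (fst z) (snd z)"
      using nbhd_mono by blast
  qed
  then show ?thesis by force
qed

lemma compact_imp_closed_cantor:
  assumes "compact K"
  shows "closed (K :: cantor set)"
proof -
  have "Hausdorff_space (euclidean :: bool topology)"
    unfolding Hausdorff_space_def
  proof (intro allI impI)
    fix x y :: bool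
    assume "x \<in> topspace euclidean \<and> y \<in> topspace euclidean \<and> x \<noteq> y"
    then show "\<exists>U V. openin euclidean U \<and> openin euclidean V \<and> x \<in> U \<and> y \<in> V \<and> disjnt U V"
      by (intro exI[of _ "{x}"] exI[of _ "{y}"]) (auto simp: open_discrete)
  qed
  then have "Hausdorff_space (euclidean :: cantor topology)"
    unfolding euclidean_product_topology[symmetric] by (simp add: Hausdorff_space_product_topology)
  then show ?thesis
    using compactin_imp_closedin[of euclidean K] assms by (simp add: compactin_euclidean_iff)
qed

text \<open>A name for the cylinder of \<open>x\<close>: a choice that depends on
  \<open>trunc n x\<close> alone is constant on cylinders of length \<open>n\<close>.\<close>

definition trunc :: "nat \<Rightarrow> cantor \<Rightarrow> cantor" where
  "trunc n x i \<longleftrightarrow> i < n \<and> x i"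

lemma trunc_eq_iff: "trunc n x = trunc n y \<longleftrightarrow> agree n x y"
  unfolding trunc_def agree_def fun_eq_iff by blast

lemma homeomorphism_compact_cantor:
  fixes h :: "cantor \<Rightarrow> cantor"
  assumes "compact L" and cont: "continuous_on L h" and inj: "inj_on h L"
  shows "homeomorphism L (h ` L) h (inv_into L h)"
proof (rule homeomorphismI)
  show "continuous_on (h ` L) (inv_into L h)"
    unfolding continuous_on_closed_invariant
  proof (intro allI impI)
    fix B :: "cantor set" assume "closed B"
    then have "compact (L \<inter> B)" using assms(1) by (rule compact_Int_closed[rotated])
    then have "closed (h ` (L \<inter> B))"
      using compact_imp_closed_cantor[OF compact_continuous_image[OF continuous_on_subset[OF cont]]]
      by simp
    moreover have "h ` (L \<inter> B) \<inter> h ` L = inv_into L h -` B \<inter> h ` L"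
      using inj by (auto simp: inv_into_f_f dest: inj_onD[OF inj])
    ultimately show "\<exists>A. closed A \<and> A \<inter> h ` L = inv_into L h -` B \<inter> h ` L" by blast
  qed
qed (use cont inj in \<open>auto simp: inv_into_f_f inv_into_into f_inv_into_f\<close>)

text \<open>A clopen partition encoded by its equivalence relation: open classes are also closed
  and, by compactness, finite in number. Common refinement becomes conjunction and pullback becomes
  composition.\<close>

definition clopen_eq :: "(cantor \<Rightarrow> cantor \<Rightarrow> bool) \<Rightarrow> bool" where
  "clopen_eq E \<longleftrightarrow> equivp E \<and> (\<forall>x. eventually (E x) (nhds x))"

lemma clopen_eqD:
  assumes "clopen_eq E"
  shows "E x x" "E x y \<Longrightarrow> E y x" "E x y \<Longrightarrow> E y z \<Longrightarrow> E x z" "eventually (E x) (nhds x)"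
    "E x y \<Longrightarrow> eventually (E x) (nhds y)"
proof -
  have E: "equivp E" "\<And>x. eventually (E x) (nhds x)"
    using assms unfolding clopen_eq_def by blast+
  show "E x x" by (rule equivp_reflp[OF E(1)])
  show "E x y \<Longrightarrow> E y x" by (rule equivp_symp[OF E(1)])
  show "E x y \<Longrightarrow> E y z \<Longrightarrow> E x z" by (rule equivp_transp[OF E(1)])
  show "eventually (E x) (nhds x)" by (rule E(2))
  assume xy: "E x y"
  show "eventually (E x) (nhds y)"
    using E(2)[of y] by (rule eventually_mono) (rule equivp_transp[OF E(1), OF xy])
qed

lemma clopen_eqI:
  assumes "\<And>x. E x x" "\<And>x y. E x y \<Longrightarrow> E y x" "\<And>x y z. E x y \<Longrightarrow> E y z \<Longrightarrow> E x z"
    "\<And>x. eventually (E x) (nhds x)"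
  shows "clopen_eq E"
proof -
  have "equivp E"
    by (intro equivpI reflpI sympI transpI) (use assms(1-3) in blast)+
  then show ?thesis using assms(4) by (simp add: clopen_eq_def)
qed

lemma clopen_eq_agree: "clopen_eq (agree n)"
  by (rule clopen_eqI) (blast intro: agree_refl agree_sym agree_trans eventually_agree)+

lemma clopen_eq_conj:
  assumes "clopen_eq E" "clopen_eq F"
  shows "clopen_eq (\<lambda>x y. E x y \<and> F x y)"
proof (rule clopen_eqI)
  show "eventually (\<lambda>y. E x y \<and> F x y) (nhds x)" for x
    by (intro eventually_conj clopen_eqD(4) assms)
qed (use clopen_eqD(1-3)[OF assms(1)] clopen_eqD(1-3)[OF assms(2)] in blast)+

lemma clopen_eq_comp:
  assumes "clopen_eq E" "continuous_on UNIV g"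
  shows "clopen_eq (\<lambda>x y. E (g x) (g y))"
proof (rule clopen_eqI)
  show "eventually (\<lambda>y. E (g x) (g y)) (nhds x)" for x
    by (intro eventually_comp[OF assms(2)] clopen_eqD(4) assms)
qed (use clopen_eqD(1-3)[OF assms(1)] in blast)+

lemma clopen_eq_Ball:
  assumes "finite S" "\<And>s. s \<in> S \<Longrightarrow> clopen_eq (E s)"
  shows "clopen_eq (\<lambda>x y. \<forall>s\<in>S. E s x y)"
proof (rule clopen_eqI)
  show "eventually (\<lambda>y. \<forall>s\<in>S. E s x y) (nhds x)" for x
    by (intro eventually_ball_finite ballI clopen_eqD(4) assms)
qed (use assms(2) clopen_eqD(1-3) in blast)+

section \<open>Ample systems\<close>

text \<open>\<open>HOL-Algebra\<close> occupies the syntax of \<open>inv\<close>.\<close>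

abbreviation hinv :: "('a \<Rightarrow> 'b) \<Rightarrow> 'b \<Rightarrow> 'a" where
  "hinv \<equiv> inv_into UNIV"

definition fsubgroup :: "(cantor \<Rightarrow> cantor) set \<Rightarrow> bool" where
  "fsubgroup S \<longleftrightarrow> finite S \<and> id \<in> S \<and> (\<forall>f\<in>S. \<forall>g\<in>S. f \<circ> g \<in> S) \<and> (\<forall>f\<in>S. hinv f \<in> S)"

text \<open>Ampleness in local form. In \<open>full\<close> a bijection only has to agree locally
  with members of \<open>G\<close>; compactness recovers the finite set of the usual definition, and
  continuity comes for free. \<open>fix_in\<close> says that fixed point sets are open,
  \<open>fin_in\<close> is local finiteness.\<close>

locale ample_system =
  fixes G :: "(cantor \<Rightarrow> cantor) set"
  assumes id_in: "id \<in> G"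
    and comp_in: "f \<in> G \<Longrightarrow> g \<in> G \<Longrightarrow> f \<circ> g \<in> G"
    and inv_in: "g \<in> G \<Longrightarrow> hinv g \<in> G"
    and bij_in: "g \<in> G \<Longrightarrow> bij g"
    and cont_in: "g \<in> G \<Longrightarrow> continuous_on UNIV g"
    and full: "bij f \<Longrightarrow> (\<And>x. \<exists>g\<in>G. eventually (\<lambda>y. f y = g y) (nhds x)) \<Longrightarrow> f \<in> G"
    and fix_in: "g \<in> G \<Longrightarrow> g x = x \<Longrightarrow> eventually (\<lambda>y. g y = y) (nhds x)"
    and fin_in: "finite A \<Longrightarrow> A \<subseteq> G \<Longrightarrow> \<exists>S. fsubgroup S \<and> A \<subseteq> S \<and> S \<subseteq> G"
    and countable_G: "countable G"
begin

lemma inv_simps [simp]: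
  assumes "g \<in> G"
  shows "hinv g (g x) = x" "g (hinv g x) = x" "hinv (hinv g) = g"
  using bij_in[OF assms]
  by (auto simp: bij_is_inj bij_is_surj surj_f_inv_f inv_inv_eq)

lemma comp_inv [simp]: "f \<in> G \<Longrightarrow> g \<in> G \<Longrightarrow> hinv (f \<circ> g) = hinv g \<circ> hinv f"
  by (simp add: bij_in o_inv_distrib)

lemma inj_in: "g \<in> G \<Longrightarrow> g x = g y \<longleftrightarrow> x = y"
  using bij_in by (auto simp: bij_def inj_def)

lemma eventually_G: "g \<in> G \<Longrightarrow> eventually P (nhds (g x)) \<Longrightarrow> eventually (\<lambda>y. P (g y)) (nhds x)"
  using eventually_comp cont_in by blast

text \<open>The element \<open>hinv h \<circ> g\<close> fixes \<open>x\<close>, hence fixes a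
  neighbourhood. With \<open>neq_in\<close>, the coincidence set of two members of \<open>G\<close>
  is clopen.\<close>

lemma eq_in:
  assumes "g \<in> G" "h \<in> G" "g x = h x"
  shows "eventually (\<lambda>y. g y = h y) (nhds x)"
proof -
  have "(hinv h \<circ> g) x = x" using assms by simp
  then have "eventually (\<lambda>y. (hinv h \<circ> g) y = y) (nhds x)"
    using assms by (intro fix_in comp_in inv_in)
  then show ?thesis
    by (rule eventually_mono) (use assms inv_simps in \<open>metis comp_apply\<close>)
qed

lemma neq_in:
  assumes "g \<in> G" "h \<in> G" "g x \<noteq> h x"
  shows "eventually (\<lambda>y. g y \<noteq> h y) (nhds x)"
  using assms cont_in eventually_neq by blast

definition orb :: "cantor \<Rightarrow> cantor \<Rightarrow> bool" where
  "orb x y \<longleftrightarrow> (\<exists>g\<in>G. g x = y)"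

lemma orb_refl [simp]: "orb x x"
  unfolding orb_def using id_in id_apply by metis

lemma orb_sym: "orb x y \<Longrightarrow> orb y x"
  unfolding orb_def using inv_in inv_simps by metis

lemma orb_trans: "orb x y \<Longrightarrow> orb y z \<Longrightarrow> orb x z"
  unfolding orb_def using comp_in comp_apply by metis

lemma orb_G [simp]: "g \<in> G \<Longrightarrow> orb x (g x)"
  unfolding orb_def by blast

definition sparse_set :: "cantor set \<Rightarrow> bool" where
  "sparse_set L \<longleftrightarrow> closed L \<and> (\<forall>x\<in>L. \<forall>y\<in>L. orb x y \<longrightarrow> x = y)"

text \<open>In the literature's terms, a finite group of homeomorphisms permuting the classes of a
  clopen partition, and acting trivially on each class that it preserves, is a unit system.\<close>

definition unit_system :: "(cantor \<Rightarrow> cantor) set \<Rightarrow> (cantor \<Rightarrow> cantor \<Rightarrow> bool) \<Rightarrow> bool" where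
  "unit_system S E \<longleftrightarrow> fsubgroup S \<and> S \<subseteq> G \<and> clopen_eq E \<and>
     (\<forall>s\<in>S. \<forall>x y. E x y \<longrightarrow> E (s x) (s y)) \<and> (\<forall>s\<in>S. \<forall>x. E x (s x) \<longrightarrow> s x = x)"

text \<open>Take a finite group \<open>S\<close> containing \<open>A\<close>. Its fixed point sets
  are clopen, so compactness gives one \<open>n\<close> such that every point moved by some
  \<open>s\<close> leaves its cylinder of length \<open>n\<close> under that \<open>s\<close>.
  Intersecting the \<open>S\<close>-translates of the partition into these cylinders, refined by
  \<open>E\<close>, makes it invariant.\<close>

lemma unit_system_exists:
  assumes "finite A" "A \<subseteq> G" "clopen_eq E"
  obtains S F where "unit_system S F" "A \<subseteq> S" "\<And>x y. F x y \<Longrightarrow> E x y"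
proof -
  obtain S where S: "fsubgroup S" "A \<subseteq> S" "S \<subseteq> G" using fin_in assms by metis
  have fS: "finite S" and idS: "id \<in> S" using S(1) by (auto simp: fsubgroup_def)
  have "\<exists>n. \<forall>x\<in>UNIV. \<forall>s\<in>S. agree n x (s x) \<longrightarrow> s x = x"
  proof (rule compact_uniform[OF compact_cantor])
    fix x :: cantor
    have "\<exists>n. eventually (\<lambda>y. agree n y (s y) \<longrightarrow> s y = y) (nhds x)" if "s \<in> S" for s
    proof (cases "s x = x")
      case True
      then have "eventually (\<lambda>y. s y = y) (nhds x)" using fix_in S(3) that by blast
      then show ?thesis by (auto elim: eventually_mono)
    next
      case False
      then obtain i where "x i \<noteq> s x i" by fastforce
      then have i: "\<not> agree (Suc i) x (s x)" by (auto simp: agree_def)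
      have "eventually (\<lambda>y. agree (Suc i) x y) (nhds x)" by (rule eventually_agree)
      moreover have "eventually (\<lambda>y. agree (Suc i) (s x) (s y)) (nhds x)"
        using eventually_agree eventually_G that S(3) by blast
      ultimately have "eventually (\<lambda>y. \<not> agree (Suc i) y (s y)) (nhds x)"
        by eventually_elim (use i agree_sym agree_trans in blast)
      then show ?thesis by (auto elim: eventually_mono)
    qed
    then obtain n where n: "\<And>s. s \<in> S \<Longrightarrow> eventually (\<lambda>y. agree (n s) y (s y) \<longrightarrow> s y = y) (nhds x)"
      by metis
    have "eventually (\<lambda>y. \<forall>s\<in>S. agree (n s) y (s y) \<longrightarrow> s y = y) (nhds x)"
      by (rule eventually_ball_finite) (use n fS in auto)
    then have "eventually (\<lambda>y. \<forall>s\<in>S. agree (Max (n ` S)) y (s y) \<longrightarrow> s y = y) (nhds x)"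
      by (rule eventually_mono) (use fS agree_mono in \<open>meson Max_ge finite_imageI imageI\<close>)
    then show "\<exists>n. eventually (\<lambda>y. \<forall>s\<in>S. agree n y (s y) \<longrightarrow> s y = y) (nhds x)" by blast
  qed (use agree_mono in blast)
  then obtain n where n: "\<And>x s. s \<in> S \<Longrightarrow> agree n x (s x) \<Longrightarrow> s x = x" by auto
  define F where "F x y \<longleftrightarrow> (\<forall>s\<in>S. E (s x) (s y) \<and> agree n (s x) (s y))" for x y
  have "clopen_eq F"
    unfolding F_def
  proof (rule clopen_eq_Ball[OF fS])
    fix s assume "s \<in> S"
    then have "continuous_on UNIV s" using S(3) cont_in by blast
    from clopen_eq_comp[OF clopen_eq_conj[OF assms(3) clopen_eq_agree[of n]] this]
    show "clopen_eq (\<lambda>x y. E (s x) (s y) \<and> agree n (s x) (s y))" .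
  qed
  moreover have "F (s x) (s y)" if "s \<in> S" "F x y" for s x y
    unfolding F_def
  proof
    fix t assume "t \<in> S"
    then have "t \<circ> s \<in> S" using that S(1) by (auto simp: fsubgroup_def)
    then show "E (t (s x)) (t (s y)) \<and> agree n (t (s x)) (t (s y))"
      using bspec[OF that(2)[unfolded F_def], of "t \<circ> s"] by simp
  qed
  moreover have *: "E x y \<and> agree n x y" if "F x y" for x y
    using bspec[OF that[unfolded F_def] idS] by simp
  ultimately have "unit_system S F" unfolding unit_system_def using S(1,3) n * by meson
  then show thesis by (rule that) (use S(2) * in blast)+
qed

end

locale minimal_ample_system = ample_system +
  assumes minimal: "\<exists>g\<in>G. agree n z (g x)"
begin

lemma minimal_avoid:
  assumes "finite F"
  obtains g where "g \<in> G" "agree n z (g x)" "g x \<notin> F"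
proof -
  obtain m w where w: "\<And>y. agree m w y \<Longrightarrow> y \<notin> F \<and> agree n z y"
    using avoid_finite[OF assms, of n z] by metis
  obtain g where "g \<in> G" "agree m w (g x)" using minimal by blast
  then show thesis using w that by blast
qed

end

section \<open>Extending homeomorphisms between sparse sets\<close>

context minimal_ample_system
begin

text \<open>Near each \<open>y\<close> in \<open>L'\<close>, minimality supplies a \<open>g\<close>
  that moves \<open>y\<close> into the \<open>F\<close>-class of \<open>h' y\<close> without fixing
  it. Compactness makes one cylinder length \<open>N\<close> work for all \<open>y\<close>, and
  \<open>\<phi>\<close> is glued from one such \<open>g\<close> per cylinder. It may fail to be
  injective across cylinders; sparsity takes care of this later.\<close>

lemma local_displacement:
  assumes hom: "homeomorphism L L' h h'" and L': "closed L'"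
    and E: "clopen_eq E" and F: "clopen_eq F"
  obtains N \<phi> where
    "\<And>x. \<exists>g\<in>G. \<forall>y. agree N x y \<longrightarrow> \<phi> y = g y"
    "\<And>y v. y \<in> L' \<Longrightarrow> agree N y v \<Longrightarrow> \<phi> v \<noteq> v \<and> F (h' y) (\<phi> v) \<and> E y v"
proof -
  \<comment> \<open>The clause on \<open>h' v\<close> lets the same \<open>g\<close> serve all
    points of \<open>L'\<close> in the cylinder of \<open>y\<close>, so that \<open>g\<close> can be
    chosen per cylinder rather than per point.\<close>
  define P where "P n y \<longleftrightarrow> (y \<in> L' \<longrightarrow> (\<exists>g\<in>G. \<forall>v. agree n y v \<longrightarrow>
    g v \<noteq> v \<and> F (h' y) (g v) \<and> E y v \<and> (v \<in> L' \<longrightarrow> F (h' y) (h' v))))" for n y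
  have h'ev: "eventually (\<lambda>v. v \<in> L' \<longrightarrow> F (h' y) (h' v)) (nhds y)" if "y \<in> L'" for y
  proof -
    have "continuous_on L' h'" using hom by (simp add: homeomorphism_def)
    then have "(h' \<longlongrightarrow> h' y) (at y within L')" using that by (simp add: continuous_on)
    moreover obtain U where "open U" "h' y \<in> U" "\<forall>z\<in>U. F (h' y) z"
      using clopen_eqD(4)[OF F, of "h' y"] by (auto simp: eventually_nhds)
    ultimately have "eventually (\<lambda>v. F (h' y) (h' v)) (at y within L')"
      using topological_tendstoD eventually_mono by (metis (mono_tags, lifting))
    then show ?thesis
      unfolding eventually_at_filter by (rule eventually_mono) (use clopen_eqD(1)[OF F] in auto)
  qed
  have "\<exists>n. \<forall>y\<in>L'. P n y"
  proof (rule compact_uniform[OF compact_closed_cantor[OF L']])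
    fix y assume y: "y \<in> L'"
    obtain k where k: "\<And>z. agree k (h' y) z \<Longrightarrow> F (h' y) z"
      using clopen_eqD(4)[OF F, of "h' y"] by (auto simp: eventually_nhds_cantor)
    obtain g where g: "g \<in> G" "agree k (h' y) (g y)" "g y \<noteq> y"
      using minimal_avoid[of "{y}" k "h' y" y] by auto
    have "eventually (\<lambda>v. g v \<noteq> id v) (nhds y)" using neq_in[OF g(1) id_in] g(3) by simp
    moreover have "eventually (\<lambda>v. F (h' y) (g v)) (nhds y)"
      using eventually_G[OF g(1) clopen_eqD(5)[OF F k[OF g(2)]]] .
    ultimately have "eventually (\<lambda>v. g v \<noteq> v \<and> F (h' y) (g v) \<and> E y v \<and>
        (v \<in> L' \<longrightarrow> F (h' y) (h' v))) (nhds y)"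
      using clopen_eqD(4)[OF E, of y] h'ev[OF y] by eventually_elim auto
    then obtain n where n: "\<And>v. agree n y v \<Longrightarrow> g v \<noteq> v \<and> F (h' y) (g v) \<and> E y v \<and>
        (v \<in> L' \<longrightarrow> F (h' y) (h' v))" by (auto simp: eventually_nhds_cantor)
    have "P n z" if yz: "agree n y z" for z
      unfolding P_def
    proof
      assume zL: "z \<in> L'"
      have F1: "F (h' z) (h' y)" using n[OF yz] zL clopen_eqD(2)[OF F] by blast
      have E1: "E z y" using n[OF yz] clopen_eqD(2)[OF E] by blast
      show "\<exists>g\<in>G. \<forall>v. agree n z v \<longrightarrow>
        g v \<noteq> v \<and> F (h' z) (g v) \<and> E z v \<and> (v \<in> L' \<longrightarrow> F (h' z) (h' v))"
      proof (intro bexI[OF _ g(1)] allI impI)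
        fix v assume "agree n z v"
        then show "g v \<noteq> v \<and> F (h' z) (g v) \<and> E z v \<and> (v \<in> L' \<longrightarrow> F (h' z) (h' v))"
          using n[OF agree_trans[OF yz]] clopen_eqD(3)[OF F F1] clopen_eqD(3)[OF E E1] by blast
      qed
    qed
    then show "\<exists>n. eventually (\<lambda>z. P n z) (nhds y)"
      by (intro exI[of _ n] eventually_mono[OF eventually_agree[of n y]])
  next
    show "P n x" if "m \<le> n" "P m x" for m n x
      using that agree_mono unfolding P_def by meson
  qed
  then obtain N where N: "\<And>y. y \<in> L' \<Longrightarrow> P N y" by blast
  define good where "good t g \<longleftrightarrow> g \<in> G \<and> (\<forall>y v. y \<in> L' \<longrightarrow> trunc N y = t \<longrightarrow> agree N y v \<longrightarrow>
    g v \<noteq> v \<and> F (h' y) (g v) \<and> E y v)" for t g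
  have ex: "\<exists>g. good (trunc N y) g" if y: "y \<in> L'" for y
  proof -
    obtain g where g: "g \<in> G" "\<And>v. agree N y v \<Longrightarrow>
      g v \<noteq> v \<and> F (h' y) (g v) \<and> E y v \<and> (v \<in> L' \<longrightarrow> F (h' y) (h' v))"
      using N[OF y] y unfolding P_def by blast
    have "g v \<noteq> v \<and> F (h' z) (g v) \<and> E z v"
      if z: "z \<in> L'" "trunc N z = trunc N y" "agree N z v" for z v
    proof -
      have yz: "agree N y z" using z(2) trunc_eq_iff agree_sym by metis
      show ?thesis
        using g(2)[OF yz] g(2)[OF agree_trans[OF yz z(3)]] z(1)
          clopen_eqD(2,3)[OF F] clopen_eqD(2,3)[OF E] by meson
    qed
    then show ?thesis unfolding good_def using g(1) by blast
  qed
  \<comment> \<open>On cylinders that miss \<open>L'\<close> the condition \<open>good\<close>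
    amounts to membership in \<open>G\<close>, so any element of \<open>G\<close> may be taken
    there.\<close>
  define T where "T t = (if \<exists>g. good t g then SOME g. good t g else id)" for t
  have Tgood: "good t (T t)" if "\<exists>g. good t g" for t
    unfolding T_def using someI_ex[OF that] that by simp
  have TG: "T t \<in> G" for t
  proof (cases "\<exists>g. good t g")
    case True
    then show ?thesis using Tgood unfolding good_def by blast
  next
    case False
    then show ?thesis using id_in by (simp add: T_def)
  qed
  show thesis
  proof (rule that[of N "\<lambda>v. T (trunc N v) v"])
    show "\<exists>g\<in>G. \<forall>y. agree N x y \<longrightarrow> T (trunc N y) y = g y" for x
      using TG trunc_eq_iff by metis
    show "T (trunc N v) v \<noteq> v \<and> F (h' y) (T (trunc N v) v) \<and> E y v"
      if y: "y \<in> L'" "agree N y v" for y v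
    proof -
      have *: "trunc N v = trunc N y" using y(2) trunc_eq_iff by metis
      show ?thesis using Tgood[OF ex[OF y(1)]] y unfolding good_def * by blast
    qed
  qed
qed

lemma unit_systemD:
  assumes "unit_system S E"
  shows "finite S" "id \<in> S" "s \<in> S \<Longrightarrow> t \<in> S \<Longrightarrow> s \<circ> t \<in> S" "s \<in> S \<Longrightarrow> hinv s \<in> S"
    "s \<in> S \<Longrightarrow> s \<in> G" "clopen_eq E" "s \<in> S \<Longrightarrow> E x y \<Longrightarrow> E (s x) (s y)"
    "s \<in> S \<Longrightarrow> E x (s x) \<Longrightarrow> s x = x"
proof -
  have S: "fsubgroup S" "S \<subseteq> G" and E: "clopen_eq E" "\<forall>s\<in>S. \<forall>x y. E x y \<longrightarrow> E (s x) (s y)"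
    "\<forall>s\<in>S. \<forall>x. E x (s x) \<longrightarrow> s x = x"
    using assms unfolding unit_system_def by simp_all
  show "finite S" "id \<in> S" "s \<in> S \<Longrightarrow> t \<in> S \<Longrightarrow> s \<circ> t \<in> S" "s \<in> S \<Longrightarrow> hinv s \<in> S"
    using S(1) unfolding fsubgroup_def by simp_all
  show "s \<in> S \<Longrightarrow> s \<in> G" "clopen_eq E" using S(2) E(1) by blast+
  show "E (s x) (s y)" if "s \<in> S" "E x y" using E(2)[rule_format, OF that] .
  show "s x = x" if "s \<in> S" "E x (s x)" using E(3)[rule_format, OF that] .
qed

text \<open>The involution exchanges a small neighbourhood \<open>W\<close> of \<open>L'\<close> with a copy \<open>\<phi> ` W\<close>, extended
  \<open>S\<close>-equivariantly. Sparsity makes the \<open>S\<close>-translates of \<open>L'\<close> and \<open>\<phi> ` L'\<close> disjoint, and by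
  compactness this persists on \<open>W\<close>.\<close>

lemma centralizing_involution:
  assumes hom: "homeomorphism L L' h h'" and L': "sparse_set L'"
    and SE: "unit_system S E" and Eh: "\<And>x. x \<in> L \<Longrightarrow> E x (h x)" and F: "clopen_eq F"
  obtains \<mu> where "\<mu> \<in> G" "\<And>x. \<mu> (\<mu> x) = x" "\<And>s x. s \<in> S \<Longrightarrow> \<mu> (s x) = s (\<mu> x)"
    "\<And>x. E x (\<mu> x)" "\<And>x. x \<in> L \<Longrightarrow> F x (\<mu> (h x))"
proof -
  have clL': "closed L'" and sp: "\<And>x y. x \<in> L' \<Longrightarrow> y \<in> L' \<Longrightarrow> orb x y \<Longrightarrow> x = y"
    using L' unfolding sparse_set_def by simp_all
  note finS = unit_systemD(1)[OF SE] and idS = unit_systemD(2)[OF SE]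
    and compS = unit_systemD(3)[OF SE] and invS = unit_systemD(4)[OF SE]
    and SG = unit_systemD(5)[OF SE] and E = unit_systemD(6)[OF SE]
    and inva = unit_systemD(7)[OF SE] and sep = unit_systemD(8)[OF SE]
  note Er = clopen_eqD(1)[OF E] and Es = clopen_eqD(2)[OF E] and Et = clopen_eqD(3)[OF E]
  \<comment> \<open>Displacement is applied to \<open>E\<close> and \<open>F\<close> together:
    \<open>h' y\<close> is \<open>E\<close>-equivalent to \<open>y\<close> by \<open>Eh\<close>, so
    \<open>\<phi>\<close> keeps points near \<open>L'\<close> in their
    \<open>E\<close>-classes.\<close>
  define EF where "EF x y \<longleftrightarrow> E x y \<and> F x y" for x y
  have EF: "clopen_eq EF" using clopen_eq_conj[OF E F] unfolding EF_def .
  obtain N \<phi> where \<phi>loc: "\<And>x. \<exists>g\<in>G. \<forall>y. agree N x y \<longrightarrow> \<phi> y = g y"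
    and \<phi>EF: "\<And>y v. y \<in> L' \<Longrightarrow> agree N y v \<Longrightarrow> \<phi> v \<noteq> v \<and> EF (h' y) (\<phi> v) \<and> E y v"
    using local_displacement[OF hom clL' E EF] by metis
  note \<phi> = \<phi>EF[unfolded EF_def]
  have h'L: "h' y \<in> L" "h (h' y) = y" if "y \<in> L'" for y
    using hom that by (auto simp: homeomorphism_def)
  have \<phi>E: "E v (\<phi> v)" if "y \<in> L'" "agree N y v" for y v
  proof -
    have "E (h' y) y" using Eh[OF h'L(1)] h'L(2) that(1) by metis
    then show ?thesis using \<phi>[OF that] Es Et by meson
  qed
  have \<phi>orb: "orb v (\<phi> v)" for v
    using \<phi>loc[of v] agree_refl orb_G by metis
  have \<phi>cont: "continuous_on UNIV \<phi>"
    unfolding continuous_iff_agree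
  proof (intro allI)
    fix x n
    obtain g where g: "g \<in> G" "\<And>y. agree N x y \<Longrightarrow> \<phi> y = g y" using \<phi>loc by blast
    have "eventually (\<lambda>y. agree n (g x) (g y)) (nhds x)"
      using eventually_G[OF g(1) eventually_agree] .
    with eventually_agree[of N x] show "eventually (\<lambda>y. agree n (\<phi> x) (\<phi> y)) (nhds x)"
      by eventually_elim (simp add: g)
  qed
  \<comment> \<open>On \<open>L'\<close> sparsity yields \<open>x = y\<close> where \<open>Q\<close>
    says \<open>agree N x y\<close>. Equality is not an open condition, so the clopen
    \<open>agree N\<close> is spread to a neighbourhood instead, and \<open>W1\<close> and
    \<open>W3\<close> recover equality from it with the unit system.\<close>
  define Q where "Q x y \<longleftrightarrow> (\<forall>s\<in>S. (s x = y \<longrightarrow> agree N x y) \<and> s (\<phi> x) \<noteq> y \<and>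
    (s (\<phi> x) = \<phi> y \<longrightarrow> agree N x y))" for x y
  have "\<exists>n. \<forall>x\<in>nbhd n L'. \<forall>y\<in>nbhd n L'. Q x y"
  proof (rule nbhd_pairs[OF clL'])
    show "Q x y" if xy: "x \<in> L'" "y \<in> L'" for x y
      unfolding Q_def
    proof (intro ballI conjI impI)
      fix s assume s: "s \<in> S"
      show "agree N x y" if "s x = y" using sp[OF xy] that orb_G[OF SG[OF s]] by force
      show "agree N x y" if "s (\<phi> x) = \<phi> y"
      proof -
        have "orb x y" using that \<phi>orb orb_G[OF SG[OF s]] orb_trans orb_sym by metis
        then show ?thesis using sp[OF xy] by simp
      qed
      show "s (\<phi> x) \<noteq> y"
      proof
        assume *: "s (\<phi> x) = y"
        then have "orb x y" using \<phi>orb orb_G[OF SG[OF s]] orb_trans by metis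
        then have "x = y" using sp[OF xy] by simp
        \<comment> \<open>Here \<open>s\<close> returns \<open>\<phi> x\<close> to its own
          \<open>E\<close>-class and hence fixes it, which contradicts the displacement
          \<open>\<phi> x \<noteq> x\<close>.\<close>
        then have "E (\<phi> x) (s (\<phi> x))" using * \<phi>E[OF xy(1) agree_refl] Es by simp
        then have "\<phi> x = x" using sep[OF s, of "\<phi> x"] * \<open>x = y\<close> by metis
        then show False using \<phi>[OF xy(1) agree_refl] by blast
      qed
    qed
  next
    fix x y assume Qxy: "Q x y"
    have c: "continuous_on UNIV (\<lambda>z::cantor\<times>cantor. f (fst z))" "continuous_on UNIV (\<lambda>z::cantor\<times>cantor. f (snd z))"
      if "continuous_on UNIV f" for f :: "cantor \<Rightarrow> cantor"
      by (rule continuous_on_compose2[OF that], simp_all add: continuous_on_fst continuous_on_snd)+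
    have ag: "eventually (\<lambda>z. agree N (fst z) (snd z)) (nhds (x, y))" if "agree N x y"
    proof -
      have "eventually (\<lambda>z. agree N x (fst z)) (nhds (x, y))"
        by (rule eventually_comp[of fst "agree N x"]) (simp_all add: eventually_agree continuous_on_fst)
      moreover have "eventually (\<lambda>z. agree N y (snd z)) (nhds (x, y))"
        by (rule eventually_comp[of snd "agree N y"]) (simp_all add: eventually_agree continuous_on_snd)
      ultimately show ?thesis
        by eventually_elim (use that agree_sym agree_trans in blast)
    qed
    show "eventually (\<lambda>z. Q (fst z) (snd z)) (nhds (x, y))"
      unfolding Q_def
    proof (intro eventually_ball_finite[OF finS] ballI eventually_conj)
      fix s assume s: "s \<in> S"
      have cs: "continuous_on UNIV s" "continuous_on UNIV (\<lambda>x. s (\<phi> x))"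
        using cont_in[OF SG[OF s]] continuous_on_compose2[OF _ \<phi>cont, of UNIV s] by auto
      have Qs: "s x = y \<longrightarrow> agree N x y" "s (\<phi> x) \<noteq> y" "s (\<phi> x) = \<phi> y \<longrightarrow> agree N x y"
        using Qxy s by (auto simp: Q_def)
      have ci: "continuous_on UNIV (\<lambda>z::cantor\<times>cantor. snd z)" by (simp add: continuous_on_snd)
      show "eventually (\<lambda>z. s (fst z) = snd z \<longrightarrow> agree N (fst z) (snd z)) (nhds (x, y))"
      proof (cases "agree N x y")
        case True
        show ?thesis using ag[OF True] by (rule eventually_mono) simp
      next
        case False
        with Qs have "s x \<noteq> y" by simp
        then have "eventually (\<lambda>z. s (fst z) \<noteq> snd z) (nhds (x, y))"
          using eventually_neq[OF c(1)[OF cs(1)] ci, of "(x, y)"] by simp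
        then show ?thesis by (rule eventually_mono) simp
      qed
      show "eventually (\<lambda>z. s (\<phi> (fst z)) \<noteq> snd z) (nhds (x, y))"
        using eventually_neq[OF c(1)[OF cs(2)] ci, of "(x, y)"] Qs by simp
      show "eventually (\<lambda>z. s (\<phi> (fst z)) = \<phi> (snd z) \<longrightarrow> agree N (fst z) (snd z)) (nhds (x, y))"
      proof (cases "agree N x y")
        case True
        show ?thesis using ag[OF True] by (rule eventually_mono) simp
      next
        case False
        with Qs have "s (\<phi> x) \<noteq> \<phi> y" by simp
        then have "eventually (\<lambda>z. s (\<phi> (fst z)) \<noteq> \<phi> (snd z)) (nhds (x, y))"
          using eventually_neq[OF c(1)[OF cs(2)] c(2)[OF \<phi>cont], of "(x, y)"] by simp
        then show ?thesis by (rule eventually_mono) simp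
      qed
    qed
  qed
  then obtain n0 where n0: "\<And>x y. x \<in> nbhd n0 L' \<Longrightarrow> y \<in> nbhd n0 L' \<Longrightarrow> Q x y" by blast
  \<comment> \<open>\<open>n0\<close> gives \<open>Q\<close> on \<open>W\<close>; \<open>N\<close>
    puts every point of \<open>W\<close> into the \<open>N\<close>-cylinder of a point of
    \<open>L'\<close>, where \<open>\<phi>\<close> is controlled.\<close>
  define W where "W = nbhd (max n0 N) L'"
  have WQ: "Q v w" if "v \<in> W" "w \<in> W" for v w
    using n0 nbhd_mono[of n0 "max n0 N"] that unfolding W_def by auto
  have WN: "\<exists>y\<in>L'. agree N y v" if "v \<in> W" for v
    using that agree_mono[of "max n0 N" _ v N] unfolding W_def nbhd_def by auto
  have W\<phi>: "E v (\<phi> v)" if "v \<in> W" for v using WN[OF that] \<phi>E by blast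
  have WE: "E v w" if vw: "v \<in> W" "agree N v w" for v w
  proof -
    obtain y where y: "y \<in> L'" "agree N y v" using WN[OF vw(1)] by blast
    show ?thesis
      using \<phi>[OF y] \<phi>[OF y(1) agree_trans[OF y(2) vw(2)]] Es Et by meson
  qed
  have W1: "v = w" if vw: "v \<in> W" "w \<in> W" "s \<in> S" "s v = w" for v w s
  proof -
    have "agree N v w" using WQ[OF vw(1,2)] vw(3,4) unfolding Q_def by blast
    then have "E v (s v)" using WE[OF vw(1)] vw(4) by simp
    then show ?thesis using sep[OF vw(3)] vw(4) by metis
  qed
  have W2: "s (\<phi> v) \<noteq> w" if vw: "v \<in> W" "w \<in> W" "s \<in> S" for v w s
    using WQ[OF vw(1,2)] vw(3) unfolding Q_def by blast
  have W3: "v = w" if vw: "v \<in> W" "w \<in> W" "s \<in> S" "s (\<phi> v) = \<phi> w" for v w s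
  proof -
    have a: "agree N v w" using WQ[OF vw(1,2)] vw(3,4) unfolding Q_def by blast
    have "E (\<phi> v) (s (\<phi> v))" using W\<phi>[OF vw(1)] W\<phi>[OF vw(2)] WE[OF vw(1) a] vw(4) Es Et by metis
    then have eq: "\<phi> v = \<phi> w" using sep[OF vw(3)] vw(4) by metis
    obtain g where g: "g \<in> G" "\<And>y. agree N v y \<Longrightarrow> \<phi> y = g y" using \<phi>loc by blast
    show ?thesis using g(2)[OF a] g(2)[OF agree_refl] eq inj_in[OF g(1)] by metis
  qed
  \<comment> \<open>Both \<open>v\<close> and \<open>\<phi> v\<close> lie in one
    \<open>E\<close>-class, and an \<open>r\<close> preserving that class fixes all its points.
    Equal stabilizers make \<open>s v \<mapsto> s (\<phi> v)\<close> well defined and injective,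
    which is the content of \<open>u1\<close> and \<open>u2\<close>; \<open>u3\<close> keeps the two
    kinds of translates apart.\<close>
  have stab: "r (\<phi> v) = \<phi> v \<longleftrightarrow> r v = v" if r: "r \<in> S" and v: "v \<in> W" for r v
  proof
    assume "r v = v"
    then have "E v (r (\<phi> v))" using inva[OF r W\<phi>[OF v]] by simp
    then show "r (\<phi> v) = \<phi> v" using sep[OF r] W\<phi>[OF v] Es Et by meson
  next
    assume "r (\<phi> v) = \<phi> v"
    then have "E (r v) (\<phi> v)" using inva[OF r W\<phi>[OF v]] by simp
    then show "r v = v" using sep[OF r] W\<phi>[OF v] Es Et by meson
  qed
  have quot: "s x = t y \<longleftrightarrow> (hinv t \<circ> s) x = y" if "s \<in> S" "t \<in> S" for s t x y
    using inv_simps[OF SG[OF that(2)]] by (metis comp_apply)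
  have u1: "s (\<phi> v) = t (\<phi> w)" if vw: "s \<in> S" "t \<in> S" "v \<in> W" "w \<in> W" "s v = t w" for s t v w
  proof -
    have r: "hinv t \<circ> s \<in> S" using compS invS vw by blast
    have eq: "(hinv t \<circ> s) v = w" using quot vw by blast
    have "v = w" using W1[OF vw(3,4) r eq] .
    then show ?thesis using quot[OF vw(1,2)] stab[OF r vw(3)] eq by blast
  qed
  have u2: "s v = t w" if vw: "s \<in> S" "t \<in> S" "v \<in> W" "w \<in> W" "s (\<phi> v) = t (\<phi> w)" for s t v w
  proof -
    have r: "hinv t \<circ> s \<in> S" using compS invS vw by blast
    have eq: "(hinv t \<circ> s) (\<phi> v) = \<phi> w" using quot vw by blast
    have "v = w" using W3[OF vw(3,4) r eq] .
    then show ?thesis using quot[OF vw(1,2)] stab[OF r vw(3)] eq by blast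
  qed
  have u3: "s (\<phi> v) \<noteq> t w" if vw: "s \<in> S" "t \<in> S" "v \<in> W" "w \<in> W" for s t v w
    using quot[OF vw(1,2)] W2[OF vw(3,4)] compS invS vw by blast
  \<comment> \<open>The graph of the equivariant exchange; \<open>\<mu>\<close> is the identity off
    its domain.\<close>
  define A where "A x z \<longleftrightarrow> (\<exists>s\<in>S. \<exists>v\<in>W. (x = s v \<and> z = s (\<phi> v)) \<or> (x = s (\<phi> v) \<and> z = s v))" for x z
  have Afun: "z = z'" if zz: "A x z" "A x z'" for x z z'
  proof -
    obtain s v where s: "s \<in> S" "v \<in> W" "(x = s v \<and> z = s (\<phi> v)) \<or> (x = s (\<phi> v) \<and> z = s v)"
      using zz(1) unfolding A_def by blast
    obtain t w where t: "t \<in> S" "w \<in> W" "(x = t w \<and> z' = t (\<phi> w)) \<or> (x = t (\<phi> w) \<and> z' = t w)"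
      using zz(2) unfolding A_def by blast
    show ?thesis
      using s(3) t(3) u1[OF s(1) t(1) s(2) t(2)] u2[OF s(1) t(1) s(2) t(2)]
        u3[OF s(1) t(1) s(2) t(2)] u3[OF t(1) s(1) t(2) s(2)] by metis
  qed
  have Asym: "A z x" if "A x z" for x z using that unfolding A_def by blast
  have AS: "A (t x) (t z)" if t: "t \<in> S" and xz: "A x z" for t x z
  proof -
    obtain s v where s: "s \<in> S" "v \<in> W" "(x = s v \<and> z = s (\<phi> v)) \<or> (x = s (\<phi> v) \<and> z = s v)"
      using xz unfolding A_def by blast
    show ?thesis unfolding A_def
      using s(2,3) by (intro bexI[OF _ compS[OF t s(1)]] bexI[of _ v]) auto
  qed
  define \<mu> where "\<mu> x = (if \<exists>z. A x z then THE z. A x z else x)" for x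
  have \<mu>A: "\<mu> x = z" if "A x z" for x z
    using that Afun unfolding \<mu>_def by (auto intro: the_equality)
  have \<mu>id: "\<mu> x = x" if "\<And>z. \<not> A x z" for x
    using that unfolding \<mu>_def by auto
  have A\<mu>: "A x (\<mu> x) \<or> (\<forall>z. \<not> A x z)" for x using \<mu>A by blast
  have invol: "\<mu> (\<mu> x) = x" for x
    using A\<mu>[of x] \<mu>A Asym \<mu>id by metis
  have comm: "\<mu> (s x) = s (\<mu> x)" if s: "s \<in> S" for s x
  proof (cases "\<exists>z. A x z")
    case True
    then show ?thesis using AS[OF s] \<mu>A by metis
  next
    case False
    have "\<not> A (s x) z" for z
      using AS[OF invS[OF s], of "s x" z] False inv_simps[OF SG[OF s]] by auto
    then show ?thesis using False \<mu>id by metis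
  qed
  have \<mu>E: "E x (\<mu> x)" for x
  proof (cases "\<exists>z. A x z")
    case True
    then obtain s v where s: "s \<in> S" "v \<in> W"
      "(x = s v \<and> \<mu> x = s (\<phi> v)) \<or> (x = s (\<phi> v) \<and> \<mu> x = s v)"
      using A\<mu>[of x] unfolding A_def by blast
    then show ?thesis using inva[OF s(1) W\<phi>[OF s(2)]] Es by metis
  next
    case False
    then show ?thesis using \<mu>id Er by metis
  qed
  have evW: "eventually (\<lambda>y. y \<in> W) (nhds v)" if "v \<in> W" for v
    using eventually_nbhd that unfolding W_def by blast
  have clW: "closed W" unfolding W_def by (rule closed_nbhd)
  have cl\<phi>W: "closed (\<phi> ` W)"
    using compact_imp_closed_cantor[OF compact_continuous_image[OF
      continuous_on_subset[OF \<phi>cont subset_UNIV] compact_closed_cantor[OF clW]]] .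
  have "\<mu> \<in> G"
  proof (rule full)
    show "bij \<mu>" using invol by (rule involuntory_imp_bij)
    fix x
    have "(\<exists>s\<in>S. \<exists>v\<in>W. x = s v) \<or> (\<exists>s\<in>S. \<exists>v\<in>W. x = s (\<phi> v))"
      if s: "s \<in> S" "hinv s x \<in> W \<or> hinv s x \<in> \<phi> ` W" for s
    proof -
      have x: "x = s (hinv s x)" using inv_simps(2)[OF SG[OF s(1)]] by simp
      from s(2) show ?thesis
      proof
        assume "hinv s x \<in> W"
        then show ?thesis using s(1) x by blast
      next
        assume "hinv s x \<in> \<phi> ` W"
        then obtain w where "w \<in> W" "hinv s x = \<phi> w" by blast
        with x have "x = s (\<phi> w)" by simp
        then show ?thesis using s(1) \<open>w \<in> W\<close> by blast
      qed
    qed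
    \<comment> \<open>Near a translate of \<open>W\<close> the map \<open>\<mu>\<close> is a
      conjugate of a local form \<open>g\<close> of \<open>\<phi>\<close> followed by
      \<open>s\<close>, near a translate of the image of \<open>W\<close> it is the local inverse,
      and elsewhere the identity. The third case is open because \<open>W\<close> and its image are
      closed and \<open>S\<close> is finite.\<close>
    then consider (1) s v where "s \<in> S" "v \<in> W" "x = s v" | (2) s v where "s \<in> S" "v \<in> W" "x = s (\<phi> v)"
      | (3) "\<And>s. s \<in> S \<Longrightarrow> hinv s x \<notin> W \<and> hinv s x \<notin> \<phi> ` W"
      by blast
    then show "\<exists>g\<in>G. eventually (\<lambda>y. \<mu> y = g y) (nhds x)"
    proof cases
      case 1
      obtain g where g: "g \<in> G" "\<And>y. agree N v y \<Longrightarrow> \<phi> y = g y" using \<phi>loc by blast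
      have sG: "s \<in> G" "hinv s \<in> G" using SG 1 inv_in by blast+
      have v: "hinv s x = v" using 1 sG by simp
      have "eventually (\<lambda>y. hinv s y \<in> W \<and> agree N v (hinv s y)) (nhds x)"
        using eventually_G[OF sG(2), of "\<lambda>y. y \<in> W \<and> agree N v y" x]
          eventually_conj[OF evW[OF 1(2)] eventually_agree] v by simp
      then have "eventually (\<lambda>y. \<mu> y = (s \<circ> g \<circ> hinv s) y) (nhds x)"
      proof (rule eventually_mono)
        fix y assume y: "hinv s y \<in> W \<and> agree N v (hinv s y)"
        have "A y (s (\<phi> (hinv s y)))" unfolding A_def using y 1(1) sG(1) inv_simps by metis
        then show "\<mu> y = (s \<circ> g \<circ> hinv s) y" using \<mu>A g(2) y by simp
      qed
      then show ?thesis using comp_in sG g(1) by blast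
    next
      case 2
      obtain g where g: "g \<in> G" "\<And>y. agree N v y \<Longrightarrow> \<phi> y = g y" using \<phi>loc by blast
      have sG: "s \<in> G" "hinv s \<in> G" "hinv g \<in> G" "hinv g \<circ> hinv s \<in> G"
        using SG 2 inv_in comp_in g(1) by blast+
      have v: "(hinv g \<circ> hinv s) x = v" using 2 sG g by simp
      have "eventually (\<lambda>y. (hinv g \<circ> hinv s) y \<in> W \<and> agree N v ((hinv g \<circ> hinv s) y)) (nhds x)"
        using eventually_G[OF sG(4), of "\<lambda>y. y \<in> W \<and> agree N v y" x]
          eventually_conj[OF evW[OF 2(2)] eventually_agree] v by simp
      then have "eventually (\<lambda>y. \<mu> y = (s \<circ> (hinv g \<circ> hinv s)) y) (nhds x)"
      proof (rule eventually_mono)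
        fix y assume y: "(hinv g \<circ> hinv s) y \<in> W \<and> agree N v ((hinv g \<circ> hinv s) y)"
        let ?w = "(hinv g \<circ> hinv s) y"
        have "s (\<phi> ?w) = y" using g(2)[of ?w] y sG(1) g(1) by simp
        then have "A y (s ?w)" unfolding A_def using y 2(1) by metis
        then show "\<mu> y = (s \<circ> (hinv g \<circ> hinv s)) y" using \<mu>A by simp
      qed
      then show ?thesis using comp_in sG by blast
    next
      case 3
      have "eventually (\<lambda>y. \<forall>s\<in>S. hinv s y \<notin> W \<and> hinv s y \<notin> \<phi> ` W) (nhds x)"
      proof (intro eventually_ball_finite[OF finS] ballI)
        fix s assume s: "s \<in> S"
        have "eventually (\<lambda>y. y \<notin> W \<and> y \<notin> \<phi> ` W) (nhds (hinv s x))"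
          using 3[OF s] by (intro eventually_conj closed_not_eventually clW cl\<phi>W) auto
        then show "eventually (\<lambda>y. hinv s y \<notin> W \<and> hinv s y \<notin> \<phi> ` W) (nhds x)"
          by (rule eventually_G[OF inv_in[OF SG[OF s]]])
      qed
      then have "eventually (\<lambda>y. \<mu> y = id y) (nhds x)"
      proof (rule eventually_mono)
        fix y assume y: "\<forall>s\<in>S. hinv s y \<notin> W \<and> hinv s y \<notin> \<phi> ` W"
        have "\<not> A y z" for z
          unfolding A_def using y SG inv_simps(1) by (metis image_eqI)
        then show "\<mu> y = id y" using \<mu>id by simp
      qed
      then show ?thesis using id_in by blast
    qed
  qed
  moreover have "F x (\<mu> (h x))" if x: "x \<in> L" for x
  proof -
    have hx: "h x \<in> L'" "h' (h x) = x" using hom x by (auto simp: homeomorphism_def)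
    have "h x \<in> W" using hx subset_nbhd unfolding W_def by blast
    then have "A (h x) (\<phi> (h x))"
      unfolding A_def by (intro bexI[OF _ idS] bexI[of _ "h x"]) simp_all
    then have "\<mu> (h x) = \<phi> (h x)" by (rule \<mu>A)
    then show ?thesis using \<phi>[OF hx(1) agree_refl] hx(2) by simp
  qed
  ultimately show thesis using that invol comm \<mu>E by blast
qed

text \<open>An approximation \<open>l\<close> of the extension of \<open>h\<close>: it agrees with \<open>h\<close> up to \<open>E\<close>, and later
  approximations \<open>l2\<close> induce the same conjugation on \<open>S\<close>. Both notions are symmetric under
  replacing \<open>h\<close>, \<open>l\<close> by their inverses and transporting \<open>S\<close>, \<open>E\<close> along \<open>l\<close>, so the
  forth step of the back-and-forth construction also gives the back step.\<close>

definition approximates ::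
  "cantor set \<Rightarrow> (cantor \<Rightarrow> cantor) \<Rightarrow> (cantor \<Rightarrow> cantor) \<Rightarrow> (cantor \<Rightarrow> cantor) set \<Rightarrow>
    (cantor \<Rightarrow> cantor \<Rightarrow> bool) \<Rightarrow> bool" where
  "approximates L h l S E \<longleftrightarrow> l \<in> G \<and> unit_system S E \<and> (\<forall>x\<in>L. E x (hinv l (h x)))"

definition refines ::
  "(cantor \<Rightarrow> cantor) \<Rightarrow> (cantor \<Rightarrow> cantor) set \<Rightarrow> (cantor \<Rightarrow> cantor \<Rightarrow> bool) \<Rightarrow>
    (cantor \<Rightarrow> cantor) \<Rightarrow> (cantor \<Rightarrow> cantor) set \<Rightarrow> (cantor \<Rightarrow> cantor \<Rightarrow> bool) \<Rightarrow> bool" where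
  "refines l S E l2 S2 E2 \<longleftrightarrow> S \<subseteq> S2 \<and> (\<forall>x y. E2 x y \<longrightarrow> E x y) \<and>
     (\<forall>y. E (hinv l y) (hinv l2 y)) \<and> (\<forall>s\<in>S. \<forall>y. l2 (s (hinv l2 y)) = l (s (hinv l y)))"

lemma approximatesD:
  assumes "approximates L h l S E"
  shows "l \<in> G" "unit_system S E" "x \<in> L \<Longrightarrow> E x (hinv l (h x))"
  using assms unfolding approximates_def by simp_all

lemma refinesD:
  assumes "refines l S E l2 S2 E2"
  shows "S \<subseteq> S2" "E2 x y \<Longrightarrow> E x y" "E (hinv l y) (hinv l2 y)"
    "s \<in> S \<Longrightarrow> l2 (s (hinv l2 y)) = l (s (hinv l y))"
  using assms unfolding refines_def by simp_all

lemma refines_refl: "clopen_eq E \<Longrightarrow> refines l S E l S E"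
  unfolding refines_def by (simp add: clopen_eqD(1))

lemma refines_trans:
  assumes "clopen_eq E" and r: "refines l S E l2 S2 E2" and r': "refines l2 S2 E2 l3 S3 E3"
  shows "refines l S E l3 S3 E3"
  unfolding refines_def
proof (intro conjI allI impI ballI)
  show "S \<subseteq> S3" using refinesD(1)[OF r] refinesD(1)[OF r'] by simp
  show "E x y" if "E3 x y" for x y using refinesD(2)[OF r] refinesD(2)[OF r'] that by simp
  show "E (hinv l y) (hinv l3 y)" for y
    using clopen_eqD(3)[OF assms(1) refinesD(3)[OF r] refinesD(2)[OF r refinesD(3)[OF r']]] .
  show "l3 (s (hinv l3 y)) = l (s (hinv l y))" if "s \<in> S" for s y
    using refinesD(4)[OF r that] refinesD(4)[OF r' subsetD[OF refinesD(1)[OF r] that]] by simp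
qed

section \<open>The back-and-forth construction\<close>

lemma sparse_set_image:
  assumes "sparse_set L" "g \<in> G"
  shows "sparse_set (g ` L)"
  unfolding sparse_set_def
proof (intro conjI ballI impI)
  have "g ` L = hinv g -` L" using inv_simps[OF assms(2)] by (auto simp: image_iff) metis
  moreover have "closed (hinv g -` L)"
    using assms cont_in inv_in by (intro closed_vimage) (auto simp: sparse_set_def)
  ultimately show "closed (g ` L)" by simp
next
  fix x y assume "x \<in> g ` L" "y \<in> g ` L" and xy: "orb x y"
  then obtain u v where uv: "u \<in> L" "v \<in> L" "x = g u" "y = g v" by blast
  have "orb u x" "orb v y" using uv assms(2) by simp_all
  then have "orb u v" using xy orb_sym orb_trans by meson
  then have "u = v" using uv assms(1) unfolding sparse_set_def by blast
  then show "x = y" using uv by simp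
qed

text \<open>The error of \<open>l\<close> is measured by \<open>hinv l \<circ> h\<close>, which
  moves points of \<open>L\<close> within their \<open>E\<close>-classes. An involution
  \<open>\<mu>\<close> corrects it up to the finer \<open>E2\<close>, and the new approximation is
  \<open>l \<circ> \<mu>\<close>. Since \<open>\<mu>\<close> commutes with \<open>S\<close>,
  conjugation of \<open>S\<close> is unchanged.\<close>

lemma forward_step:
  assumes hom: "homeomorphism L L' h h'" and L': "sparse_set L'"
    and ap: "approximates L h l S E" and A: "finite A" "A \<subseteq> G" and F: "clopen_eq F"
  obtains l2 S2 E2 where "approximates L h l2 S2 E2" "refines l S E l2 S2 E2" "A \<subseteq> S2"
    "\<And>x y. E2 x y \<Longrightarrow> F x y"
proof -
  note l = approximatesD(1)[OF ap] and SE = approximatesD(2)[OF ap]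
  have l': "hinv l \<in> G" using l inv_in by blast
  have SA: "finite (S \<union> A)" "S \<union> A \<subseteq> G" using unit_systemD(1,5)[OF SE] A by auto
  have EF: "clopen_eq (\<lambda>x y. E x y \<and> F x y)" by (rule clopen_eq_conj[OF unit_systemD(6)[OF SE] F])
  obtain S2 E2 where u: "unit_system S2 E2" "S \<union> A \<subseteq> S2" "\<And>x y. E2 x y \<Longrightarrow> E x y \<and> F x y"
    using unit_system_exists[OF SA EF] by metis
  have "homeomorphism L' (hinv l ` L') (hinv l) l"
    unfolding homeomorphism_def using l l' inv_simps(1,2)[OF l] continuous_on_subset[OF cont_in]
    by (auto simp: image_iff)
  from homeomorphism_compose[OF hom this]
  have hom1: "homeomorphism L (hinv l ` L') (hinv l \<circ> h) (h' \<circ> l)" .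
  have "\<And>x. x \<in> L \<Longrightarrow> E x ((hinv l \<circ> h) x)" using approximatesD(3)[OF ap] by simp
  from centralizing_involution[OF hom1 sparse_set_image[OF L' l'] SE this unit_systemD(6)[OF u(1)]]
  obtain \<mu> where \<mu>: "\<mu> \<in> G" "\<And>x. \<mu> (\<mu> x) = x" "\<And>s x. s \<in> S \<Longrightarrow> \<mu> (s x) = s (\<mu> x)"
    "\<And>x. E x (\<mu> x)" "\<And>x. x \<in> L \<Longrightarrow> E2 x (\<mu> ((hinv l \<circ> h) x))" by metis
  have "hinv \<mu> x = \<mu> x" for x using inv_simps(1)[OF \<mu>(1), of "\<mu> x"] \<mu>(2) by simp
  then have inv\<mu>: "hinv (l \<circ> \<mu>) x = \<mu> (hinv l x)" for x using l \<mu>(1) by simp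
  show thesis
  proof (rule that)
    show "approximates L h (l \<circ> \<mu>) S2 E2"
      unfolding approximates_def inv\<mu> using comp_in l u(1) \<mu>(1,5) by simp
    show "refines l S E (l \<circ> \<mu>) S2 E2"
      unfolding refines_def inv\<mu> using u(2,3) \<mu> by simp
    show "A \<subseteq> S2" using u(2) by simp
    show "F x y" if "E2 x y" for x y using u(3)[OF that] by simp
  qed
qed

definition conj_set :: "(cantor \<Rightarrow> cantor) \<Rightarrow> (cantor \<Rightarrow> cantor) set \<Rightarrow> (cantor \<Rightarrow> cantor) set" where
  "conj_set l S = (\<lambda>s. l \<circ> s \<circ> hinv l) ` S"

definition conj_eq :: "(cantor \<Rightarrow> cantor) \<Rightarrow> (cantor \<Rightarrow> cantor \<Rightarrow> bool) \<Rightarrow> cantor \<Rightarrow> cantor \<Rightarrow> bool" where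
  "conj_eq l E x y \<longleftrightarrow> E (hinv l x) (hinv l y)"

lemma approximates_flip:
  assumes hom: "homeomorphism L L' h h'" and ap: "approximates L h l S E"
  shows "approximates L' h' (hinv l) (conj_set l S) (conj_eq l E)"
proof -
  note l = approximatesD(1)[OF ap] and SE = approximatesD(2)[OF ap]
  note l' = inv_in[OF l] and il = inv_simps[OF l]
  note E = unit_systemD(6)[OF SE]
  have fs: "fsubgroup (conj_set l S)"
    unfolding fsubgroup_def
  proof (intro conjI ballI)
    show "finite (conj_set l S)" using unit_systemD(1)[OF SE] by (simp add: conj_set_def)
    have "id = l \<circ> id \<circ> hinv l" using il by (simp add: fun_eq_iff)
    then show "id \<in> conj_set l S" unfolding conj_set_def using unit_systemD(2)[OF SE] by blast
  next
    fix f g assume "f \<in> conj_set l S" "g \<in> conj_set l S"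
    then obtain s t where st: "s \<in> S" "t \<in> S" "f = l \<circ> s \<circ> hinv l" "g = l \<circ> t \<circ> hinv l"
      unfolding conj_set_def by blast
    have "f \<circ> g = l \<circ> (s \<circ> t) \<circ> hinv l" by (rule ext) (simp add: st il)
    then show "f \<circ> g \<in> conj_set l S"
      unfolding conj_set_def using unit_systemD(3)[OF SE st(1,2)] by blast
  next
    fix f assume "f \<in> conj_set l S"
    then obtain s where s: "s \<in> S" "f = l \<circ> s \<circ> hinv l" unfolding conj_set_def by blast
    have "hinv f = l \<circ> hinv s \<circ> hinv l"
      using s unit_systemD(5)[OF SE s(1)] l l' il comp_in by (simp add: comp_assoc)
    then show "hinv f \<in> conj_set l S"
      unfolding conj_set_def using unit_systemD(4)[OF SE s(1)] by blast
  qed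
  have u: "unit_system (conj_set l S) (conj_eq l E)"
    unfolding unit_system_def
  proof (intro conjI ballI allI impI)
    show "fsubgroup (conj_set l S)" by (rule fs)
    show "conj_set l S \<subseteq> G"
      unfolding conj_set_def using comp_in l l' unit_systemD(5)[OF SE] by blast
    show "clopen_eq (conj_eq l E)"
      unfolding conj_eq_def using clopen_eq_comp[OF E cont_in[OF l']] .
  next
    fix s x y assume "s \<in> conj_set l S" and xy: "conj_eq l E x y"
    then obtain t where t: "t \<in> S" "s = l \<circ> t \<circ> hinv l" unfolding conj_set_def by blast
    show "conj_eq l E (s x) (s y)"
      using unit_systemD(7)[OF SE t(1) xy[unfolded conj_eq_def]] t(2) il by (simp add: conj_eq_def)
  next
    fix s x assume "s \<in> conj_set l S" and x: "conj_eq l E x (s x)"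
    then obtain t where t: "t \<in> S" "s = l \<circ> t \<circ> hinv l" unfolding conj_set_def by blast
    have "t (hinv l x) = hinv l x"
      using unit_systemD(8)[OF SE t(1)] x t(2) il by (simp add: conj_eq_def)
    then show "s x = x" using t(2) il by simp
  qed
  have "conj_eq l E y (hinv (hinv l) (h' y))" if y: "y \<in> L'" for y
  proof -
    have "h' y \<in> L" "h (h' y) = y" using hom y by (auto simp: homeomorphism_def)
    then have "E (h' y) (hinv l y)" using approximatesD(3)[OF ap, of "h' y"] by simp
    then show ?thesis unfolding conj_eq_def using il clopen_eqD(2)[OF E] by simp
  qed
  then show ?thesis unfolding approximates_def using l' u by blast
qed

text \<open>This is \<open>forward_step\<close> for \<open>h'\<close> and the flipped data, read
  back through \<open>hinv m\<close>. Control of \<open>F\<close> on the target side makes the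
  approximations converge, just as control on the source side does for their inverses.\<close>

lemma backward_step:
  assumes hom: "homeomorphism L L' h h'" and L: "sparse_set L"
    and ap: "approximates L h l S E" and A: "finite A" "A \<subseteq> G" and F: "clopen_eq F"
  obtains l2 S2 E2 where "approximates L h l2 S2 E2" "refines l S E l2 S2 E2"
    "\<And>a. a \<in> A \<Longrightarrow> hinv l2 \<circ> a \<circ> l2 \<in> S2" "\<And>x y. E2 x y \<Longrightarrow> F (l2 x) (l2 y)"
proof -
  note l = approximatesD(1)[OF ap] and SE = approximatesD(2)[OF ap]
  note l' = inv_in[OF l] and il = inv_simps[OF l]
  note E = unit_systemD(6)[OF SE]
  have hom': "homeomorphism L' L h' h" using hom by (rule homeomorphism_symD)
  obtain m T D where ap2: "approximates L' h' m T D"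
    and r: "refines (hinv l) (conj_set l S) (conj_eq l E) m T D"
    and T: "A \<subseteq> T" and D: "\<And>x y. D x y \<Longrightarrow> F x y"
    using forward_step[OF hom' L approximates_flip[OF hom ap] A F] by metis
  note m = approximatesD(1)[OF ap2]
  note m' = inv_in[OF m] and im = inv_simps[OF m]
  \<comment> \<open>In terms of \<open>m \<circ> l\<close>, the flipped refinement says that this
    map commutes with \<open>S\<close> (fact \<open>c\<close>) and that its inverse moves points
    within their \<open>E\<close>-classes (fact \<open>e\<close>).\<close>
  have c: "m (l (s (hinv l (hinv m y)))) = s y" if "s \<in> S" for s y
  proof -
    have "l \<circ> s \<circ> hinv l \<in> conj_set l S" using that unfolding conj_set_def by blast
    from refinesD(4)[OF r this, of y] show ?thesis using il by simp
  qed
  have e: "E y (hinv l (hinv m y))" for y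
    using refinesD(3)[OF r, of y] il by (simp add: conj_eq_def)
  show thesis
  proof (rule that)
    show "approximates L h (hinv m) (conj_set m T) (conj_eq m D)"
      by (rule approximates_flip[OF hom' ap2])
    show "refines l S E (hinv m) (conj_set m T) (conj_eq m D)"
      unfolding refines_def
    proof (intro conjI ballI allI impI subsetI)
      fix s assume s: "s \<in> S"
      have "l \<circ> s \<circ> hinv l \<in> T" using refinesD(1)[OF r] s unfolding conj_set_def by blast
      moreover have "s = m \<circ> (l \<circ> s \<circ> hinv l) \<circ> hinv m" using c[OF s] by (simp add: fun_eq_iff)
      ultimately show "s \<in> conj_set m T" unfolding conj_set_def by blast
      show "hinv m (s (hinv (hinv m) y)) = l (s (hinv l y))" for y
        using c[OF s, of "m y"] im by metis
    next
      fix x y assume "conj_eq m D x y"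
      then have "E (hinv l (hinv m x)) (hinv l (hinv m y))"
        using refinesD(2)[OF r] unfolding conj_eq_def by blast
      then show "E x y" using e clopen_eqD(2,3)[OF E] by meson
    next
      fix y show "E (hinv l y) (hinv (hinv m) y)"
        using e[of "m y"] im clopen_eqD(2)[OF E] by simp
    qed
    show "hinv (hinv m) \<circ> a \<circ> hinv m \<in> conj_set m T" if "a \<in> A" for a
      unfolding conj_set_def using T that im by auto
    show "F (hinv m x) (hinv m y)" if "conj_eq m D x y" for x y
      using that D unfolding conj_eq_def by blast
  qed
qed

lemma double_step:
  assumes hom: "homeomorphism L L' h h'" and L: "sparse_set L" "sparse_set L'"
    and ap: "approximates L h l S E" and A: "finite A" "A \<subseteq> G" and F: "clopen_eq F"
  obtains l2 S2 E2 where "approximates L h l2 S2 E2" "refines l S E l2 S2 E2" "A \<subseteq> S2"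
    "\<And>a. a \<in> A \<Longrightarrow> hinv l2 \<circ> a \<circ> l2 \<in> S2" "\<And>x y. E2 x y \<Longrightarrow> F x y"
    "\<And>x y. E2 x y \<Longrightarrow> F (l2 x) (l2 y)"
proof -
  obtain l1 S1 E1 where 1: "approximates L h l1 S1 E1" "refines l S E l1 S1 E1" "A \<subseteq> S1"
    "\<And>x y. E1 x y \<Longrightarrow> F x y"
    using forward_step[OF hom L(2) ap A F] by metis
  obtain l2 S2 E2 where 2: "approximates L h l2 S2 E2" "refines l1 S1 E1 l2 S2 E2"
    "\<And>a. a \<in> A \<Longrightarrow> hinv l2 \<circ> a \<circ> l2 \<in> S2" "\<And>x y. E2 x y \<Longrightarrow> F (l2 x) (l2 y)"
    using backward_step[OF hom L(1) 1(1) A F] by metis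
  show thesis
  proof (rule that[OF 2(1)])
    show "refines l S E l2 S2 E2"
      using refines_trans[OF unit_systemD(6)[OF approximatesD(2)[OF ap]] 1(2) 2(2)] .
    show "A \<subseteq> S2" using 1(3) refinesD(1)[OF 2(2)] by simp
    show "hinv l2 \<circ> a \<circ> l2 \<in> S2" if "a \<in> A" for a using 2(3)[OF that] .
    show "F x y" if "E2 x y" for x y using 1(4)[OF refinesD(2)[OF 2(2) that]] .
    show "F (l2 x) (l2 y)" if "E2 x y" for x y using 2(4)[OF that] .
  qed
qed

text \<open>Back and forth along an enumeration \<open>e\<close> of \<open>G\<close>. The partition
  of stage \<open>n\<close> refines the cylinders of length \<open>n\<close> both before and after
  applying \<open>l\<close>, so the approximations and their inverses converge uniformly. The group
  of stage \<open>n\<close> contains the first \<open>n\<close> members \<open>a\<close> of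
  \<open>G\<close> and their conjugates \<open>hinv l \<circ> a \<circ> l\<close>, and its
  conjugation is never changed again; so conjugation by the limit maps \<open>G\<close> onto
  itself.\<close>

theorem extend_sparse_homeomorphism:
  assumes hom: "homeomorphism L L' h h'" and L: "sparse_set L" "sparse_set L'"
  obtains f f' where "homeomorphism UNIV UNIV f f'" "\<And>x. x \<in> L \<Longrightarrow> f x = h x"
    "\<And>x y. orb (f x) (f y) \<longleftrightarrow> orb x y"
proof -
  define e where "e = from_nat_into G"
  have Gne: "G \<noteq> {}" using id_in by blast
  have e_in: "e n \<in> G" for n unfolding e_def by (rule from_nat_into[OF Gne])
  have e_surj: "\<exists>n. g = e n" if "g \<in> G" for g
    using from_nat_into_surj[OF countable_G that] unfolding e_def by metis
  define P where "P n p \<longleftrightarrow> (case p of (l, S, E) \<Rightarrow> approximates L h l S E \<and> e ` {..<n} \<subseteq> S \<and>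
    (\<forall>a\<in>e ` {..<n}. hinv l \<circ> a \<circ> l \<in> S) \<and> (\<forall>x y. E x y \<longrightarrow> agree n x y) \<and>
    (\<forall>x y. E x y \<longrightarrow> agree n (l x) (l y)))" for n p
  define R where "R p q \<longleftrightarrow> (case p of (l, S, E) \<Rightarrow> case q of (l2, S2, E2) \<Rightarrow> refines l S E l2 S2 E2)"
    for p q
  have "\<exists>X. \<forall>n. P n (X n) \<and> R (X n) (X (Suc n))"
  proof (rule dependent_nat_choice)
    \<comment> \<open>With a single class the identity approximates every \<open>h\<close>, which
      starts the construction.\<close>
    have "unit_system {id} (\<lambda>_ _. True)"
      unfolding unit_system_def fsubgroup_def using id_in by (auto intro!: clopen_eqI)
    then have "approximates L h id {id} (\<lambda>_ _. True)"
      unfolding approximates_def using id_in by simp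
    then have "P 0 (id, {id}, \<lambda>_ _. True)" unfolding P_def by (simp add: agree_def)
    then show "\<exists>p. P 0 p" ..
  next
    fix p n assume "P n p"
    obtain l S E where p: "p = (l, S, E)" by (cases p)
    have ap: "approximates L h l S E" using \<open>P n p\<close> unfolding P_def p by simp
    have A: "finite (e ` {..<Suc n})" "e ` {..<Suc n} \<subseteq> G" using e_in by auto
    obtain l2 S2 E2 where 2: "approximates L h l2 S2 E2" "refines l S E l2 S2 E2"
      "e ` {..<Suc n} \<subseteq> S2" "\<And>a. a \<in> e ` {..<Suc n} \<Longrightarrow> hinv l2 \<circ> a \<circ> l2 \<in> S2"
      "\<And>x y. E2 x y \<Longrightarrow> agree (Suc n) x y" "\<And>x y. E2 x y \<Longrightarrow> agree (Suc n) (l2 x) (l2 y)"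
      using double_step[OF hom L ap A clopen_eq_agree[of "Suc n"]] by metis
    have "P (Suc n) (l2, S2, E2) \<and> R p (l2, S2, E2)"
      unfolding P_def R_def p prod.case using 2 by blast
    then show "\<exists>q. P (Suc n) q \<and> R p q" ..
  qed
  then obtain X where X: "\<And>n. P n (X n)" "\<And>n. R (X n) (X (Suc n))" by blast
  define l where "l n = fst (X n)" for n
  define S where "S n = fst (snd (X n))" for n
  define E where "E n = snd (snd (X n))" for n
  have Xn: "X n = (l n, S n, E n)" for n by (simp add: l_def S_def E_def)
  have ap: "approximates L h (l n) (S n) (E n)" and eS: "e ` {..<n} \<subseteq> S n"
    and eS': "a \<in> e ` {..<n} \<Longrightarrow> hinv (l n) \<circ> a \<circ> l n \<in> S n"
    and Eag: "E n x y \<Longrightarrow> agree n x y" and Eag': "E n x y \<Longrightarrow> agree n (l n x) (l n y)" for n a x y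
    using X(1)[of n] unfolding P_def Xn prod.case by blast+
  have ref1: "refines (l n) (S n) (E n) (l (Suc n)) (S (Suc n)) (E (Suc n))" for n
    using X(2)[of n] unfolding R_def Xn by simp
  have Ecl: "clopen_eq (E n)" for n using unit_systemD(6)[OF approximatesD(2)[OF ap]] .
  have ref: "refines (l n) (S n) (E n) (l m) (S m) (E m)" if "n \<le> m" for n m
    using that
  proof (induction m rule: dec_induct)
    case base
    show ?case using refines_refl[OF Ecl] .
  next
    case (step m)
    show ?case using refines_trans[OF Ecl step.IH ref1] .
  qed
  note lG = approximatesD(1)[OF ap] and il = inv_simps[OF approximatesD(1)[OF ap]]
  have c1: "agree n (hinv (l n) y) (hinv (l m) y)" if "n \<le> m" for n m y
    using Eag[OF refinesD(3)[OF ref[OF that]]] .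
  have c2: "agree n (l n x) (l m x)" if "n \<le> m" for n m x
    using Eag'[OF refinesD(3)[OF ref[OF that]], of "l m x"] il agree_sym by simp
  \<comment> \<open>Coordinate \<open>i\<close> is constant from stage \<open>Suc i\<close> on,
    because \<open>agree (Suc i)\<close> covers the coordinates \<open>0\<close> to
    \<open>i\<close>.\<close>
  define f where "f x i = l (Suc i) x i" for x i
  define f' where "f' y i = hinv (l (Suc i)) y i" for y i
  have cf: "agree n (f x) (l m x)" if "n \<le> m" for n m x
    unfolding agree_def
  proof (intro allI impI)
    fix i assume "i < n"
    then show "f x i = l m x i" using c2[of "Suc i" m x] that unfolding f_def agree_def by simp
  qed
  have cf': "agree n (f' y) (hinv (l m) y)" if "n \<le> m" for n m y
    unfolding agree_def
  proof (intro allI impI)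
    fix i assume "i < n"
    then show "f' y i = hinv (l m) y i" using c1[of "Suc i" m y] that unfolding f'_def agree_def by simp
  qed
  have cont: "continuous_on UNIV F"
    if F: "\<And>n x. agree n (F x) (k n x)" and k: "\<And>n. k n \<in> G" for F and k :: "nat \<Rightarrow> cantor \<Rightarrow> cantor"
    unfolding continuous_iff_agree
  proof (intro allI)
    fix x n
    show "eventually (\<lambda>y. agree n (F x) (F y)) (nhds x)"
      using eventually_G[OF k[of n] eventually_agree[of n "k n x"]]
      by (rule eventually_mono) (use F agree_trans agree_sym in metis)
  qed
  have contf: "continuous_on UNIV f" using cont[of f l] cf lG by simp
  have contf': "continuous_on UNIV f'" using cont[of f' "\<lambda>n. hinv (l n)"] cf' lG inv_in by simp
  have nearG: "\<exists>k. \<forall>z. agree k x z \<longrightarrow> agree n (g x) (g z)" if "g \<in> G" for g x n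
    using eventually_G[OF that eventually_agree[of n "g x"]] unfolding eventually_nhds_cantor .
  have f'f: "f' (f x) = x" for x
  proof (rule agree_all_eq)
    fix n
    obtain k where k: "\<forall>z. agree k (f x) z \<longrightarrow> agree n (hinv (l n) (f x)) (hinv (l n) z)"
      using nearG[OF inv_in[OF lG]] by blast
    define m where "m = max n k"
    have "agree n (hinv (l n) (f x)) (hinv (l n) (l m x))" using k cf[of k m x] by (simp add: m_def)
    moreover have "agree n (hinv (l n) (l m x)) x" using c1[of n m "l m x"] il by (simp add: m_def)
    ultimately show "agree n (f' (f x)) x" using cf'[of n n "f x"] agree_trans by blast
  qed
  have ff': "f (f' y) = y" for y
  proof (rule agree_all_eq)
    fix n
    obtain k where k: "\<forall>z. agree k (f' y) z \<longrightarrow> agree n (l n (f' y)) (l n z)"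
      using nearG[OF lG] by blast
    define m where "m = max n k"
    have "agree n (l n (f' y)) (l n (hinv (l m) y))" using k cf'[of k m y] by (simp add: m_def)
    moreover have "agree n (l n (hinv (l m) y)) y"
      using c2[of n m "hinv (l m) y"] il by (simp add: m_def)
    ultimately show "agree n (f (f' y)) y" using cf[of n n "f' y"] agree_trans by blast
  qed
  \<comment> \<open>From stage \<open>n\<close> on every \<open>l m\<close> conjugates
    \<open>s\<close> to the same \<open>t\<close>; continuity of \<open>t\<close> carries this over
    to the limit.\<close>
  have conj: "f (s x) = l n (s (hinv (l n) (f x)))" if s: "s \<in> S n" for s n x
  proof (rule agree_all_eq)
    fix j
    define t where "t = l n \<circ> (s \<circ> hinv (l n))"
    have "t \<in> G" unfolding t_def
      using comp_in lG inv_in unit_systemD(5)[OF approximatesD(2)[OF ap] s] by blast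
    then obtain k where k: "\<forall>z. agree k (f x) z \<longrightarrow> agree j (t (f x)) (t z)" using nearG by blast
    define m where "m = max n (max j k)"
    have "l m (s x) = t (l m x)"
      using refinesD(4)[OF ref[of n m] s, of "l m x"] il by (simp add: t_def m_def)
    then have "agree j (f (s x)) (t (l m x))" using cf[of j m "s x"] by (simp add: m_def)
    moreover have "agree j (t (f x)) (t (l m x))" using k cf[of k m x] by (simp add: m_def)
    ultimately show "agree j (f (s x)) (l n (s (hinv (l n) (f x))))"
      using agree_trans agree_sym unfolding t_def comp_apply by blast
  qed
  show thesis
  proof (rule that)
    show "homeomorphism UNIV UNIV f f'"
      unfolding homeomorphism_def using contf contf' f'f ff' by (metis UNIV_I UNIV_eq_I image_iff)
    show "f x = h x" if x: "x \<in> L" for x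
    proof (rule agree_all_eq)
      fix n
      have "agree n (l n x) (h x)" using Eag'[OF approximatesD(3)[OF ap x]] il by simp
      then show "agree n (f x) (h x)" using cf[of n n x] agree_trans by blast
    qed
    show "orb (f x) (f y) \<longleftrightarrow> orb x y" for x y
    proof
      assume "orb (f x) (f y)"
      then obtain n where n: "e n (f x) = f y" unfolding orb_def using e_surj by metis
      let ?s = "hinv (l (Suc n)) \<circ> e n \<circ> l (Suc n)"
      have s: "?s \<in> S (Suc n)" using eS'[of "e n" "Suc n"] by simp
      have "f (?s x) = e n (f x)" using conj[OF s, of x] il by simp
      then have "?s x = y" using n f'f by metis
      moreover have "?s \<in> G" using unit_systemD(5)[OF approximatesD(2)[OF ap] s] .
      ultimately show "orb x y" unfolding orb_def by blast
    next
      assume "orb x y"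
      then obtain n where n: "e n x = y" unfolding orb_def using e_surj by metis
      have s: "e n \<in> S (Suc n)" using eS[of "Suc n"] by auto
      have "l (Suc n) \<circ> (e n \<circ> hinv (l (Suc n))) \<in> G" using comp_in lG inv_in e_in by blast
      then show "orb (f x) (f y)" unfolding orb_def using conj[OF s, of x] n by (metis comp_apply)
    qed
  qed
qed

end

section \<open>Cutting orbits\<close>

context minimal_ample_system
begin

text \<open>For one pair \<open>(x, z)\<close> the element comes from \<open>minimal_avoid\<close>,
  and it serves all nearby pairs too. By compactness of the space of pairs finitely many elements
  suffice, and they are put into \<open>T\<close>.\<close>

lemma dense_extension:
  assumes S: "fsubgroup S" "S \<subseteq> G" and A: "finite A" "A \<subseteq> G"
  obtains T where "fsubgroup T" "S \<union> A \<subseteq> T" "T \<subseteq> G"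
    "\<And>x z. \<exists>g\<in>T. agree n z (g x) \<and> g x \<notin> (\<lambda>s. s x) ` S"
proof -
  define e where "e = from_nat_into G"
  have Gne: "G \<noteq> {}" using id_in by blast
  have e_in: "e n \<in> G" for n unfolding e_def by (rule from_nat_into[OF Gne])
  have finS: "finite S" using S(1) by (simp add: fsubgroup_def)
  have cp: "compact (UNIV \<times> UNIV :: (cantor \<times> cantor) set)"
    by (intro compact_Times compact_cantor)
  have "\<exists>N. \<forall>w\<in>UNIV \<times> UNIV. \<exists>i<N. agree n (snd w) (e i (fst w)) \<and> (\<forall>s\<in>S. e i (fst w) \<noteq> s (fst w))"
  proof (rule compact_uniform[OF cp])
    fix w :: "cantor \<times> cantor"
    obtain x z where w: "w = (x, z)" by fastforce
    obtain g where g: "g \<in> G" "agree n z (g x)" "g x \<notin> (\<lambda>s. s x) ` S"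
      using minimal_avoid[of "(\<lambda>s. s x) ` S" n z x] finS by auto
    obtain i where i: "g = e i"
      using from_nat_into_surj[OF countable_G g(1)] unfolding e_def by metis
    have 1: "eventually (\<lambda>x'. agree n (g x) (g x') \<and> (\<forall>s\<in>S. g x' \<noteq> s x')) (nhds x)"
      using S(2) g
      by (intro eventually_conj eventually_ball_finite[OF finS] ballI neq_in
          eventually_G[OF g(1) eventually_agree]) auto
    have "eventually (\<lambda>w. agree n (g x) (g (fst w)) \<and> (\<forall>s\<in>S. g (fst w) \<noteq> s (fst w))) (nhds w)"
      by (rule eventually_comp[of fst "\<lambda>x'. agree n (g x) (g x') \<and> (\<forall>s\<in>S. g x' \<noteq> s x')"])
        (simp_all only: w fst_conv 1 continuous_on_fst[OF continuous_on_id])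
    moreover have "eventually (\<lambda>w. agree n z (snd w)) (nhds w)"
      by (rule eventually_comp[of snd "agree n z"])
        (simp_all only: w snd_conv eventually_agree continuous_on_snd[OF continuous_on_id])
    ultimately have "eventually (\<lambda>w. \<exists>j<Suc i. agree n (snd w) (e j (fst w)) \<and>
        (\<forall>s\<in>S. e j (fst w) \<noteq> s (fst w))) (nhds w)"
    proof eventually_elim
      case (elim w)
      have "agree n (snd w) (e i (fst w))"
        unfolding i[symmetric]
        using agree_trans[OF agree_trans[OF agree_sym[OF elim(2)] g(2)]] elim(1) by simp
      moreover have "\<forall>s\<in>S. e i (fst w) \<noteq> s (fst w)" using elim(1) i by simp
      ultimately show ?case by (intro exI[of _ i]) simp
    qed
    then show "\<exists>N. eventually (\<lambda>w. \<exists>i<N. agree n (snd w) (e i (fst w)) \<and>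
        (\<forall>s\<in>S. e i (fst w) \<noteq> s (fst w))) (nhds w)" ..
  next
    fix m n' :: nat and w :: "cantor \<times> cantor"
    assume "m \<le> n'" "\<exists>i<m. agree n (snd w) (e i (fst w)) \<and> (\<forall>s\<in>S. e i (fst w) \<noteq> s (fst w))"
    then show "\<exists>i<n'. agree n (snd w) (e i (fst w)) \<and> (\<forall>s\<in>S. e i (fst w) \<noteq> s (fst w))"
      using less_le_trans by blast
  qed
  then obtain N where N0: "\<forall>w\<in>UNIV \<times> UNIV. \<exists>i<N. agree n (snd w) (e i (fst w)) \<and>
    (\<forall>s\<in>S. e i (fst w) \<noteq> s (fst w))" ..
  have N: "\<exists>i<N. agree n z (e i x) \<and> (\<forall>s\<in>S. e i x \<noteq> s x)" for x z
    using bspec[OF N0, of "(x, z)"] by simp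
  have "finite (S \<union> A \<union> e ` {..<N})" "S \<union> A \<union> e ` {..<N} \<subseteq> G"
    using finS S(2) A e_in by auto
  from fin_in[OF this] obtain T where T: "fsubgroup T" "S \<union> A \<union> e ` {..<N} \<subseteq> T" "T \<subseteq> G" by blast
  show thesis
  proof (rule that[OF T(1) _ T(3)])
    show "S \<union> A \<subseteq> T" using T(2) by blast
    show "\<exists>g\<in>T. agree n z (g x) \<and> g x \<notin> (\<lambda>s. s x) ` S" for x z
    proof -
      obtain i where "i < N" "agree n z (e i x)" "\<forall>s\<in>S. e i x \<noteq> s x"
        using N[of z x] by (elim exE conjE)
      moreover have "e i \<in> T" using T(2) \<open>i < N\<close> by blast
      ultimately show ?thesis by (intro bexI[of _ "e i"]) (simp_all add: image_iff)
    qed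
  qed
qed

text \<open>Iterates \<open>dense_extension\<close>, adding one member of an enumeration of
  \<open>G\<close> each time. The start \<open>{id}\<close> leaves a point alone in its level
  \<open>0\<close>, so the identity can later serve as the section through piece
  \<open>0\<close>.\<close>

lemma filtration_exists:
  obtains Gs :: "nat \<Rightarrow> (cantor \<Rightarrow> cantor) set" where
    "Gs 0 = {id}" "\<And>n. fsubgroup (Gs n)" "\<And>n. Gs n \<subseteq> Gs (Suc n)" "(\<Union>n. Gs n) = G"
    "\<And>n x z. \<exists>g\<in>Gs (Suc n). agree (Suc n) z (g x) \<and> g x \<notin> (\<lambda>s. s x) ` Gs n"
proof -
  define e where "e = from_nat_into G"
  have Gne: "G \<noteq> {}" using id_in by blast
  have e_in: "e n \<in> G" for n unfolding e_def by (rule from_nat_into[OF Gne])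
  define P where "P n S \<longleftrightarrow> fsubgroup S \<and> S \<subseteq> G \<and> (n = (0::nat) \<longrightarrow> S = {id})" for n S
  define R where "R n S T \<longleftrightarrow> S \<subseteq> T \<and> e n \<in> T \<and>
    (\<forall>x z. \<exists>g\<in>T. agree (Suc n) z (g x) \<and> g x \<notin> (\<lambda>s. s x) ` S)" for n S T
  have "\<exists>Gs. \<forall>n. P n (Gs n) \<and> R n (Gs n) (Gs (Suc n))"
  proof (rule dependent_nat_choice)
    have "P 0 {id}" unfolding P_def fsubgroup_def using id_in by simp
    then show "\<exists>S. P 0 S" ..
  next
    fix S n assume "P n S"
    then have S: "fsubgroup S" "S \<subseteq> G" unfolding P_def by simp_all
    have A: "finite {e n}" "{e n} \<subseteq> G" using e_in by simp_all
    obtain T where T: "fsubgroup T" "S \<union> {e n} \<subseteq> T" "T \<subseteq> G"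
      "\<And>x z. \<exists>g\<in>T. agree (Suc n) z (g x) \<and> g x \<notin> (\<lambda>s. s x) ` S"
      using dense_extension[OF S A, of "Suc n"] by metis
    then have "P (Suc n) T \<and> R n S T" unfolding P_def R_def by simp
    then show "\<exists>T. P (Suc n) T \<and> R n S T" ..
  qed
  then obtain Gs where P: "\<And>n. P n (Gs n)" and R: "\<And>n. R n (Gs n) (Gs (Suc n))" by blast
  show thesis
  proof (rule that)
    show "Gs 0 = {id}" using P[of 0] by (simp add: P_def)
    show "fsubgroup (Gs n)" for n using P[of n] by (simp add: P_def)
    show "Gs n \<subseteq> Gs (Suc n)" for n using R[of n] by (simp add: R_def)
    show "\<exists>g\<in>Gs (Suc n). agree (Suc n) z (g x) \<and> g x \<notin> (\<lambda>s. s x) ` Gs n" for n x z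
      using R[of n] unfolding R_def by blast
    show "(\<Union>n. Gs n) = G"
    proof
      show "(\<Union>n. Gs n) \<subseteq> G" using P unfolding P_def by blast
      show "G \<subseteq> (\<Union>n. Gs n)"
      proof
        fix g assume "g \<in> G"
        then obtain n where "g = e n"
          using from_nat_into_surj[OF countable_G] unfolding e_def by metis
        then show "g \<in> (\<Union>n. Gs n)" using R[of n] unfolding R_def by blast
      qed
    qed
  qed
qed

end

section \<open>Levels and pieces of orbits\<close>

locale filtered_system = minimal_ample_system +
  fixes Gs :: "nat \<Rightarrow> (cantor \<Rightarrow> cantor) set" and C :: "cantor set"
  assumes Gs_0: "Gs 0 = {id}"
    and Gs_sub: "fsubgroup (Gs n)"
    and Gs_Suc: "Gs n \<subseteq> Gs (Suc n)"
    and Gs_Union: "(\<Union>n. Gs n) = G"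
    and Gs_dense: "\<exists>g\<in>Gs (Suc n). agree (Suc n) z (g x) \<and> g x \<notin> (\<lambda>s. s x) ` Gs n"
    and C: "sparse_set C"
begin

lemma Gs_mono: "m \<le> n \<Longrightarrow> Gs m \<subseteq> Gs n"
  using lift_Suc_mono_le[of Gs, OF Gs_Suc] .

lemma Gs_G: "s \<in> Gs n \<Longrightarrow> s \<in> G"
  using Gs_Union by blast

lemma Gs_ex: "g \<in> G \<Longrightarrow> \<exists>n. g \<in> Gs n"
  using Gs_Union by blast

lemma Gs_group: "finite (Gs n)" "s \<in> Gs n \<Longrightarrow> t \<in> Gs n \<Longrightarrow> s \<circ> t \<in> Gs n" "s \<in> Gs n \<Longrightarrow> hinv s \<in> Gs n"
  using Gs_sub[of n] unfolding fsubgroup_def by blast+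

lemma C_unique: "k \<in> C \<Longrightarrow> k' \<in> C \<Longrightarrow> orb k k' \<Longrightarrow> k = k'"
  using C unfolding sparse_set_def by blast

text \<open>The number of the shell around \<open>k\<close> that contains \<open>x\<close>;
  meaningful only when \<open>orb k x\<close>.\<close>

definition lev :: "cantor \<Rightarrow> cantor \<Rightarrow> nat" where
  "lev x k = (LEAST m. \<exists>s\<in>Gs m. x = s k)"

lemma lev_le_iff:
  assumes "orb k x"
  shows "lev x k \<le> m \<longleftrightarrow> (\<exists>s\<in>Gs m. x = s k)"
proof
  obtain g where "g \<in> G" "x = g k" using assms unfolding orb_def by blast
  then have "\<exists>m. \<exists>s\<in>Gs m. x = s k" using Gs_ex by blast
  then have "\<exists>s\<in>Gs (lev x k). x = s k" unfolding lev_def by (rule LeastI_ex)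
  moreover assume "lev x k \<le> m"
  ultimately show "\<exists>s\<in>Gs m. x = s k" using Gs_mono by blast
next
  assume "\<exists>s\<in>Gs m. x = s k"
  then show "lev x k \<le> m" unfolding lev_def by (rule Least_le)
qed

lemma lev_self [simp]: "lev k k = 0"
  using lev_le_iff[of k k 0] Gs_0 by simp

text \<open>Near \<open>z\<close> the map \<open>a\<close> coincides with some \<open>s\<close> in
  the group of its level, and it stays different from the finitely many members of the smaller
  groups.\<close>

lemma lev_locally_constant:
  assumes a: "a \<in> G"
  shows "eventually (\<lambda>w. lev (a w) w = lev (a z) z) (nhds z)"
proof -
  define m where "m = lev (a z) z"
  define A where "A = (\<Union>j\<in>{..<m}. Gs j)"
  have o: "orb w (a w)" for w using a by simp
  obtain s where s: "s \<in> Gs m" "a z = s z" using lev_le_iff[OF o, of z m] m_def by auto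
  have "eventually (\<lambda>w. a w = s w) (nhds z)" by (rule eq_in[OF a Gs_G[OF s(1)] s(2)])
  moreover have "eventually (\<lambda>w. \<forall>t\<in>A. a w \<noteq> t w) (nhds z)"
  proof (rule eventually_ball_finite)
    show "finite A" unfolding A_def using Gs_group(1) by blast
    show "\<forall>t\<in>A. eventually (\<lambda>w. a w \<noteq> t w) (nhds z)"
    proof
      fix t assume "t \<in> A"
      then obtain j where j: "j < m" "t \<in> Gs j" unfolding A_def by blast
      have "a z \<noteq> t z" using lev_le_iff[OF o, of z j] j m_def by auto
      then show "eventually (\<lambda>w. a w \<noteq> t w) (nhds z)" by (rule neq_in[OF a Gs_G[OF j(2)]])
    qed
  qed
  ultimately show ?thesis
  proof eventually_elim
    case (elim w)
    have "lev (a w) w \<le> m" using lev_le_iff[OF o] elim(1) s(1) by blast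
    moreover have "\<not> lev (a w) w < m"
    proof
      assume "lev (a w) w < m"
      moreover obtain t where "t \<in> Gs (lev (a w) w)" "a w = t w"
        using lev_le_iff[OF o, of w "lev (a w) w"] by blast
      ultimately show False using elim(2) unfolding A_def by blast
    qed
    ultimately show ?case unfolding m_def by simp
  qed
qed

text \<open>The pieces into which an orbit through \<open>k \<in> C\<close> is cut: \<open>fst \<circ> prod_decode\<close> takes every
  value infinitely often, so each piece contains infinitely many of the increasingly dense shells
  \<open>Gs (Suc n) k - Gs n k\<close>, hence is dense.\<close>

definition side :: "cantor \<Rightarrow> cantor \<Rightarrow> nat" where
  "side x k = fst (prod_decode (lev x k))"

text \<open>Off the orbits through \<open>C\<close> the second clause is vacuous, so such orbits
  remain whole.\<close>

definition cut :: "cantor \<Rightarrow> cantor \<Rightarrow> bool" where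
  "cut x y \<longleftrightarrow> orb x y \<and> (\<forall>k\<in>C. orb k x \<longrightarrow> side x k = side y k)"

lemma cut_refl [simp]: "cut x x"
  by (simp add: cut_def)

lemma cut_sym: "cut x y \<Longrightarrow> cut y x"
  unfolding cut_def using orb_sym orb_trans by metis

lemma cut_trans: "cut x y \<Longrightarrow> cut y z \<Longrightarrow> cut x z"
  unfolding cut_def using orb_trans by metis

lemma cut_orb: "cut x y \<Longrightarrow> orb x y"
  by (simp add: cut_def)

text \<open>Let \<open>g \<in> Gs n\<close>. Levels above \<open>n\<close> are preserved by
  \<open>g\<close>, so only points \<open>v\<close> of level at most \<open>n\<close> matter. For
  these \<open>k = hinv a v\<close> with one of finitely many \<open>a \<in> Gs n\<close>, and the
  levels of \<open>v\<close> and \<open>g v\<close> over such \<open>k\<close> are locally constant;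
  closedness of \<open>C\<close> excludes those \<open>a\<close> with
  \<open>hinv a x \<notin> C\<close>.\<close>

lemma cut_open:
  assumes g: "g \<in> G" and x: "cut x (g x)"
  shows "eventually (\<lambda>v. cut v (g v)) (nhds x)"
proof -
  obtain n where n: "g \<in> Gs n" using Gs_ex[OF g] by blast
  have "eventually (\<lambda>v. hinv a v \<in> C \<longrightarrow> hinv a x \<in> C \<and> lev v (hinv a v) = lev x (hinv a x) \<and>
      lev (g v) (hinv a v) = lev (g x) (hinv a x)) (nhds x)" if a: "a \<in> Gs n" for a
  proof -
    have aG: "a \<in> G" "hinv a \<in> G" "g \<circ> a \<in> G" using Gs_G[OF a] inv_in comp_in g by blast+
    show ?thesis
    proof (cases "hinv a x \<in> C")
      case False
      have "eventually (\<lambda>v. hinv a v \<notin> C) (nhds x)"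
        using eventually_G[OF aG(2) closed_not_eventually[OF _ False]] C by (simp add: sparse_set_def)
      then show ?thesis by (rule eventually_mono) simp
    next
      case True
      have "eventually (\<lambda>w. lev (a w) w = lev (a (hinv a x)) (hinv a x) \<and>
          lev ((g \<circ> a) w) w = lev ((g \<circ> a) (hinv a x)) (hinv a x)) (nhds (hinv a x))"
        by (intro eventually_conj lev_locally_constant aG)
      from eventually_G[OF aG(2) this] show ?thesis
        by (rule eventually_mono) (use True inv_simps[OF aG(1)] in simp)
    qed
  qed
  then have "eventually (\<lambda>v. \<forall>a\<in>Gs n. hinv a v \<in> C \<longrightarrow> hinv a x \<in> C \<and>
      lev v (hinv a v) = lev x (hinv a x) \<and> lev (g v) (hinv a v) = lev (g x) (hinv a x)) (nhds x)"
    by (intro eventually_ball_finite Gs_group(1) ballI)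
  then show ?thesis
  proof (rule eventually_mono)
    fix v
    assume v: "\<forall>a\<in>Gs n. hinv a v \<in> C \<longrightarrow> hinv a x \<in> C \<and>
      lev v (hinv a v) = lev x (hinv a x) \<and> lev (g v) (hinv a v) = lev (g x) (hinv a x)"
    show "cut v (g v)"
      unfolding cut_def
    proof (intro conjI ballI impI)
      show "orb v (g v)" using g by simp
      fix k assume k: "k \<in> C" "orb k v"
      have kg: "orb k (g v)" using k(2) g orb_trans orb_G by blast
      show "side v k = side (g v) k"
      proof (cases "lev v k \<le> n")
        case True
        then obtain a where a: "a \<in> Gs n" "v = a k" using lev_le_iff[OF k(2)] by blast
        have hv: "hinv a v = k" using a inv_simps(1)[OF Gs_G[OF a(1)]] by simp
        have *: "hinv a x \<in> C" "lev v k = lev x (hinv a x)" "lev (g v) k = lev (g x) (hinv a x)"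
          using v a(1) hv k(1) by auto
        have "orb (hinv a x) x" using orb_sym orb_G[OF inv_in[OF Gs_G[OF a(1)]]] by blast
        then have "side x (hinv a x) = side (g x) (hinv a x)" using x *(1) unfolding cut_def by blast
        then show ?thesis using *(2,3) unfolding side_def by simp
      next
        case False
        have 1: "\<not> lev (g v) k \<le> n"
        proof
          assume "lev (g v) k \<le> n"
          then obtain s where s: "s \<in> Gs n" "g v = s k" using lev_le_iff[OF kg] by blast
          then have "v = (hinv g \<circ> s) k" using inv_simps(1)[OF g, of v] by simp
          then show False using False lev_le_iff[OF k(2)] Gs_group(2,3) n s(1) by blast
        qed
        \<comment> \<open>For \<open>m > n\<close> both \<open>g\<close> and \<open>hinv g\<close>
          lie in \<open>Gs m\<close>, so \<open>v\<close> and \<open>g v\<close> enter the orbit of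
          \<open>k\<close> under \<open>Gs m\<close> at the same time.\<close>
        have "lev v k \<le> m \<longleftrightarrow> lev (g v) k \<le> m" if m: "n < m" for m
        proof -
          have gm: "g \<in> Gs m" "hinv g \<in> Gs m" using n m Gs_mono[of n m] Gs_group(3) by auto
          have "(\<exists>s\<in>Gs m. v = s k) \<longleftrightarrow> (\<exists>s\<in>Gs m. g v = s k)"
          proof
            assume "\<exists>s\<in>Gs m. v = s k"
            then obtain s where "s \<in> Gs m" "v = s k" by blast
            then show "\<exists>s\<in>Gs m. g v = s k" using Gs_group(2)[OF gm(1)] by (metis comp_apply)
          next
            assume "\<exists>s\<in>Gs m. g v = s k"
            then obtain s where s: "s \<in> Gs m" "g v = s k" by blast
            then have "v = (hinv g \<circ> s) k" using inv_simps(1)[OF g, of v] by simp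
            then show "\<exists>s\<in>Gs m. v = s k" using Gs_group(2)[OF gm(2) s(1)] by blast
          qed
          then show ?thesis using lev_le_iff[OF k(2)] lev_le_iff[OF kg] by simp
        qed
        then have "lev v k = lev (g v) k" using False 1 by (metis le_antisym not_le order_refl)
        then show ?thesis by (simp add: side_def)
      qed
    qed
  qed
qed

text \<open>The group called \<open>\<Lambda>\<close> in the introduction.\<close>

definition H :: "(cantor \<Rightarrow> cantor) set" where
  "H = {g \<in> G. \<forall>x. cut x (g x)}"

text \<open>For \<open>g \<in> G\<close> with \<open>cut x (g x)\<close>, exchanging a small neighbourhood of \<open>x\<close> with its image under
  \<open>g\<close> gives an element of \<open>H\<close>.\<close>

lemma H_orbits: "(\<exists>g\<in>H. g x = y) \<longleftrightarrow> cut x y"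
proof
  assume "\<exists>g\<in>H. g x = y"
  then show "cut x y" unfolding H_def by blast
next
  assume xy: "cut x y"
  then obtain g where g: "g \<in> G" "g x = y" unfolding cut_def orb_def by blast
  show "\<exists>g\<in>H. g x = y"
  proof (cases "g x = x")
    case True
    then show ?thesis using g id_in unfolding H_def by (intro bexI[of _ id]) auto
  next
    case False
    then obtain i where i: "x i \<noteq> g x i" by fastforce
    have "eventually (\<lambda>v. agree (Suc i) (g x) (g v)) (nhds x)"
      by (rule eventually_G[OF g(1) eventually_agree])
    moreover have "eventually (\<lambda>v. cut v (g v)) (nhds x)" using cut_open[OF g(1)] xy g(2) by simp
    ultimately have "eventually (\<lambda>v. cut v (g v) \<and> \<not> agree (Suc i) x (g v)) (nhds x)"
      by eventually_elim (use i in \<open>auto simp: agree_def\<close>)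
    then obtain N0 where N0: "\<And>v. agree N0 x v \<Longrightarrow> cut v (g v) \<and> \<not> agree (Suc i) x (g v)"
      by (auto simp: eventually_nhds_cantor)
    \<comment> \<open>\<open>Suc i\<close> separates the cylinder of \<open>x\<close> from its image
      under \<open>g\<close>, since \<open>x\<close> and \<open>g x\<close> differ at
      \<open>i\<close>; the first two branches of \<open>\<mu>\<close> are then inverse to each
      other.\<close>
    define N where "N = max N0 (Suc i)"
    have N: "cut v (g v)" "\<not> agree N x (g v)" if "agree N x v" for v
      using N0[of v] agree_mono[OF that, of N0] agree_mono[of N x "g v" "Suc i"] by (auto simp: N_def)
    define \<mu> where "\<mu> v = (if agree N x v then g v else if agree N x (hinv g v) then hinv g v else v)" for v
    have g': "hinv g \<in> G" and ig: "hinv g (g v) = v" "g (hinv g v) = v" for v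
      using g inv_in inv_simps by blast+
    have N': "\<not> agree N x v" if "agree N x (hinv g v)" for v using N(2)[OF that] ig by simp
    have \<mu>1: "\<mu> v = g v" if "agree N x v" for v using that by (simp add: \<mu>_def)
    have \<mu>2: "\<mu> v = hinv g v" if "agree N x (hinv g v)" for v using that N'[OF that] by (simp add: \<mu>_def)
    have inv: "\<mu> (\<mu> v) = v" for v
    proof -
      consider "agree N x v" | "agree N x (hinv g v)" | "\<not> agree N x v" "\<not> agree N x (hinv g v)"
        by blast
      then show ?thesis
      proof cases
        case 1
        then show ?thesis using \<mu>1[OF 1] \<mu>2[of "g v"] ig(1) by simp
      next
        case 2
        then show ?thesis using \<mu>2[OF 2] \<mu>1[of "hinv g v"] ig(2) by simp
      next
        case 3
        then show ?thesis by (simp add: \<mu>_def)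
      qed
    qed
    have "\<mu> \<in> G"
    proof (rule full)
      show "bij \<mu>" using inv by (rule involuntory_imp_bij)
      fix v
      have near: "eventually (\<lambda>w. agree N x (h w) \<longleftrightarrow> agree N x (h v)) (nhds v)" if "h \<in> G" for h
        using eventually_G[OF that eventually_agree[of N "h v"]]
        by (rule eventually_mono) (use agree_sym agree_trans in blast)
      have ev: "eventually (\<lambda>w. (agree N x w \<longleftrightarrow> agree N x v) \<and>
          (agree N x (hinv g w) \<longleftrightarrow> agree N x (hinv g v))) (nhds v)"
        using near[OF id_in] near[OF g'] by (simp add: eventually_conj)
      define h where "h = (if agree N x v then g else if agree N x (hinv g v) then hinv g else id)"
      have "h \<in> G" unfolding h_def using g(1) g' id_in by simp
      moreover have "eventually (\<lambda>w. \<mu> w = h w) (nhds v)"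
        using ev by (rule eventually_mono) (simp add: \<mu>_def h_def)
      ultimately show "\<exists>h\<in>G. eventually (\<lambda>w. \<mu> w = h w) (nhds v)" by blast
    qed
    moreover have "cut v (\<mu> v)" for v
    proof -
      consider "agree N x v" | "agree N x (hinv g v)" | "\<not> agree N x v" "\<not> agree N x (hinv g v)"
        by blast
      then show ?thesis
      proof cases
        case 1
        then show ?thesis using \<mu>1[OF 1] N(1)[OF 1] by simp
      next
        case 2
        then show ?thesis using \<mu>2[OF 2] cut_sym[OF N(1)[OF 2]] ig(2) by simp
      next
        case 3
        then show ?thesis by (simp add: \<mu>_def)
      qed
    qed
    ultimately have "\<mu> \<in> H" unfolding H_def by blast
    moreover have "\<mu> x = y" unfolding \<mu>_def using g(2) by simp
    ultimately show ?thesis by blast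
  qed
qed

lemma lev_shell:
  assumes g: "g \<in> Gs (Suc m)" "g k \<notin> (\<lambda>s. s k) ` Gs m"
  shows "lev (g k) k = Suc m"
proof -
  have o: "orb k (g k)" using Gs_G[OF g(1)] by simp
  have "lev (g k) k \<le> Suc m" using lev_le_iff[OF o] g(1) by blast
  moreover have "\<not> lev (g k) k \<le> m" using lev_le_iff[OF o] g(2) by blast
  ultimately show ?thesis by simp
qed

text \<open>Being positive, the code numbers a shell \<open>Gs (Suc m) k - Gs m k\<close>; being
  large, it numbers one that meets all cylinders of length \<open>n\<close>.\<close>

lemma prod_encode_Suc: obtains m where "prod_encode (i, Suc n) = Suc m" "n \<le> m"
  using le_prod_encode_2[of "Suc n" i] by (metis Suc_le_D Suc_le_mono)

text \<open>Apart from minimality the axioms pass from \<open>G\<close> to \<open>H\<close> because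
  \<open>cut\<close> is an equivalence relation tested pointwise. Minimality holds because every
  piece is dense.\<close>

lemma minimal_ample_H: "minimal_ample_system H"
proof
  show "id \<in> H" unfolding H_def using id_in by simp
  show "f \<circ> g \<in> H" if "f \<in> H" "g \<in> H" for f g
    using that comp_in unfolding H_def by (auto intro: cut_trans)
  show "hinv g \<in> H" if g: "g \<in> H" for g
  proof -
    have gG: "g \<in> G" and c: "\<And>x. cut x (g x)" using g unfolding H_def by auto
    have "cut x (hinv g x)" for x using cut_sym[OF c[of "hinv g x"]] inv_simps(2)[OF gG] by simp
    then show ?thesis unfolding H_def using inv_in[OF gG] by blast
  qed
  show "bij g" "continuous_on UNIV g" if "g \<in> H" for g
    using that bij_in cont_in unfolding H_def by blast+
  show "f \<in> H" if f: "bij f" "\<And>x. \<exists>g\<in>H. eventually (\<lambda>y. f y = g y) (nhds x)" for f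
  proof -
    have "f \<in> G"
    proof (rule full[OF f(1)])
      show "\<exists>g\<in>G. eventually (\<lambda>y. f y = g y) (nhds x)" for x
        using f(2)[of x] unfolding H_def by blast
    qed
    moreover have "cut x (f x)" for x
    proof -
      obtain g where g: "g \<in> H" "eventually (\<lambda>y. f y = g y) (nhds x)" using f(2) by blast
      then show ?thesis using eventually_self[OF g(2)] unfolding H_def by simp
    qed
    ultimately show ?thesis unfolding H_def by blast
  qed
  show "eventually (\<lambda>y. g y = y) (nhds x)" if "g \<in> H" "g x = x" for g x
    using that fix_in unfolding H_def by blast
  have "H \<subseteq> G" unfolding H_def by blast
  then show "countable H" using countable_G by (rule countable_subset)
  show "\<exists>S. fsubgroup S \<and> A \<subseteq> S \<and> S \<subseteq> H" if A: "finite A" "A \<subseteq> H" for A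
  proof -
    have "A \<subseteq> G" using A(2) unfolding H_def by blast
    from fin_in[OF A(1) this] obtain S where S: "fsubgroup S" "A \<subseteq> S" "S \<subseteq> G" by blast
    have "fsubgroup (S \<inter> H)"
      using S(1) \<open>id \<in> H\<close> \<open>\<And>f g. f \<in> H \<Longrightarrow> g \<in> H \<Longrightarrow> f \<circ> g \<in> H\<close> \<open>\<And>g. g \<in> H \<Longrightarrow> hinv g \<in> H\<close>
      unfolding fsubgroup_def by simp
    then show ?thesis using S(2) A(2) by (intro exI[of _ "S \<inter> H"]) blast
  qed
  show "\<exists>g\<in>H. agree n z (g x)" for n z x
  proof -
    have "\<exists>y. cut x y \<and> agree n z y"
    proof (cases "\<exists>k\<in>C. orb k x")
      case False
      then show ?thesis using minimal[of n z x] unfolding cut_def orb_def by blast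
    next
      case True
      then obtain k where k: "k \<in> C" "orb k x" by blast
      \<comment> \<open>The shell with this number lies in the piece of \<open>x\<close> and is
        dense enough for cylinders of length \<open>n\<close>.\<close>
      obtain m where m: "prod_encode (side x k, Suc n) = Suc m" "n \<le> m" by (rule prod_encode_Suc)
      obtain g where g: "g \<in> Gs (Suc m)" "agree (Suc m) z (g k)" "g k \<notin> (\<lambda>s. s k) ` Gs m"
        using Gs_dense[of m z k] by blast
      have "lev (g k) k = prod_encode (side x k, Suc n)" using lev_shell[OF g(1,3)] m by simp
      then have sd: "side (g k) k = side x k" by (simp add: side_def)
      have "cut x (g k)"
        unfolding cut_def
      proof (intro conjI ballI impI)
        show "orb x (g k)" using orb_trans[OF orb_sym[OF k(2)] orb_G[OF Gs_G[OF g(1)]]] .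
        show "side x k' = side (g k) k'" if k': "k' \<in> C" "orb k' x" for k'
        proof -
          have "k' = k" using C_unique[OF k'(1) k(1) orb_trans[OF k'(2) orb_sym[OF k(2)]]] .
          then show ?thesis using sd by simp
        qed
      qed
      moreover have "agree n z (g k)" using agree_mono[OF g(2)] m(2) by simp
      ultimately show ?thesis by blast
    qed
    then obtain y where y: "cut x y" "agree n z y" by blast
    obtain g where "g \<in> H" "g x = y" using y(1) H_orbits[of x y] by blast
    then show ?thesis using y(2) by blast
  qed
qed

end

section \<open>Absorption\<close>

context ample_system
begin

text \<open>Explicit form of the glued relation: under sparsity orbits are joined only in pairs, so
  no longer chains occur. Transitivity is obtained later, when \<open>absorb\<close> exhibits this
  relation as a homeomorphic copy of \<open>orb\<close>.\<close>

definition glued :: "cantor set \<Rightarrow> (cantor \<Rightarrow> cantor) \<Rightarrow> cantor \<Rightarrow> cantor \<Rightarrow> bool" where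
  "glued C \<sigma> u v \<longleftrightarrow> orb u v \<or> (\<exists>k\<in>C. (orb k u \<or> orb (\<sigma> k) u) \<and> (orb k v \<or> orb (\<sigma> k) v))"

end

section \<open>Sections through the pieces and the Hilbert hotel shift\<close>

context filtered_system
begin

text \<open>Shell \<open>prod_encode (i, Suc i)\<close> lies in piece \<open>i\<close> and has
  points close to \<open>k\<close>. A member of \<open>Gs (Suc m)\<close> leading there is chosen in
  a locally constant way, which makes the section continuous.\<close>

lemma section_exists:
  obtains \<psi> where "\<And>k. agree i k (\<psi> k)" "\<And>k. side (\<psi> k) k = i"
    "\<And>k. \<exists>g\<in>G. eventually (\<lambda>w. \<psi> w = g w) (nhds k)"
proof -
  obtain m where m: "prod_encode (i, Suc i) = Suc m" "i \<le> m" by (rule prod_encode_Suc)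
  define good where "good g w \<longleftrightarrow> agree (Suc m) w (g w) \<and> (\<forall>s\<in>Gs m. g w \<noteq> s w)" for g w
  define A where "A w = {g \<in> Gs (Suc m). good g w}" for w
  \<comment> \<open>The choice depends on the set \<open>A w\<close> only; as membership in
    \<open>A w\<close> is decided by clopen conditions for finitely many \<open>g\<close>, it is
    locally constant.\<close>
  define a where "a w = (SOME g. g \<in> A w)" for w
  have aA: "a w \<in> A w" for w
  proof -
    obtain g where "g \<in> Gs (Suc m)" "agree (Suc m) w (g w)" "g w \<notin> (\<lambda>s. s w) ` Gs m"
      using Gs_dense[of m w w] by blast
    then have "g \<in> A w" unfolding A_def good_def by (simp add: image_iff)
    then show ?thesis unfolding a_def by (rule someI[of "\<lambda>g. g \<in> A w"])
  qed
  have aG: "a w \<in> Gs (Suc m)" and agood: "good (a w) w" for w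
    using aA[of w] unfolding A_def by simp_all
  have goodev: "eventually (\<lambda>w. good g w \<longleftrightarrow> good g k) (nhds k)" if g: "g \<in> G" for g k
  proof -
    have "eventually (\<lambda>w. g w = s w \<longleftrightarrow> g k = s k) (nhds k)" if "s \<in> Gs m" for s
    proof (cases "g k = s k")
      case True
      show ?thesis using eq_in[OF g Gs_G[OF that] True] by (rule eventually_mono) (simp add: True)
    next
      case False
      show ?thesis using neq_in[OF g Gs_G[OF that] False] by (rule eventually_mono) (simp add: False)
    qed
    then have "eventually (\<lambda>w. \<forall>s\<in>Gs m. g w = s w \<longleftrightarrow> g k = s k) (nhds k)"
      by (intro eventually_ball_finite Gs_group(1) ballI)
    moreover have "eventually (\<lambda>w. agree (Suc m) k w) (nhds k)" by (rule eventually_agree)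
    moreover have "eventually (\<lambda>w. agree (Suc m) (g k) (g w)) (nhds k)"
      by (rule eventually_G[OF g eventually_agree])
    ultimately show ?thesis
    proof eventually_elim
      case (elim w)
      have "agree (Suc m) w (g w) \<longleftrightarrow> agree (Suc m) k (g k)"
        using elim(2,3) unfolding agree_def by simp
      then show ?case using elim(1) unfolding good_def by simp
    qed
  qed
  have "eventually (\<lambda>w. \<forall>g\<in>Gs (Suc m). good g w \<longleftrightarrow> good g k) (nhds k)" for k
    by (intro eventually_ball_finite Gs_group(1) ballI) (rule goodev[OF Gs_G])
  then have aev: "eventually (\<lambda>w. a w = a k) (nhds k)" for k
  proof (rule eventually_mono)
    fix w assume "\<forall>g\<in>Gs (Suc m). good g w \<longleftrightarrow> good g k"
    then have "A w = A k" unfolding A_def by blast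
    then show "a w = a k" unfolding a_def by simp
  qed
  show thesis
  proof (rule that[of "\<lambda>w. a w w"])
    show "agree i k (a k k)" for k
      using agood[of k] agree_mono[of "Suc m" k "a k k" i] m(2) unfolding good_def by simp
    show "side (a k k) k = i" for k
    proof -
      have "a k k \<notin> (\<lambda>s. s k) ` Gs m" using agood[of k] unfolding good_def by blast
      then have "lev (a k k) k = prod_encode (i, Suc i)" using lev_shell[OF aG] m(1) by simp
      then show ?thesis by (simp add: side_def)
    qed
    show "\<exists>g\<in>G. eventually (\<lambda>w. a w w = g w) (nhds k)" for k
      using aev[of k] Gs_G[OF aG[of k]] by (intro bexI[of _ "a k"]) (erule eventually_mono, simp)
  qed
qed

lemma sections_exist:
  obtains \<psi> :: "nat \<Rightarrow> cantor \<Rightarrow> cantor" where "\<psi> 0 = id" "\<And>i k. agree i k (\<psi> i k)"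
    "\<And>i k. side (\<psi> i k) k = i" "\<And>i k. orb k (\<psi> i k)" "\<And>i. continuous_on UNIV (\<psi> i)"
proof -
  have "\<exists>\<psi>. (\<forall>k. agree i k (\<psi> k)) \<and> (\<forall>k. side (\<psi> k) k = i) \<and>
    (\<forall>k. \<exists>g\<in>G. eventually (\<lambda>w. \<psi> w = g w) (nhds k))" for i
    using section_exists[of i] by metis
  then obtain \<theta> where \<theta>: "\<And>i k. agree i k (\<theta> i k)" "\<And>i k. side (\<theta> i k) k = i"
    "\<And>i k. \<exists>g\<in>G. eventually (\<lambda>w. \<theta> i w = g w) (nhds k)" by metis
  \<comment> \<open>The identity is a section through piece \<open>0\<close>, as
    \<open>lev k k = 0\<close> and \<open>prod_decode 0 = (0, 0)\<close>.\<close>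
  define \<psi> where "\<psi> i = (if i = 0 then id else \<theta> i)" for i
  have loc: "\<exists>g\<in>G. eventually (\<lambda>w. \<psi> i w = g w) (nhds k)" for i k
  proof (cases "i = 0")
    case True
    then show ?thesis using id_in unfolding \<psi>_def by (intro bexI[of _ id]) simp_all
  next
    case False
    then show ?thesis using \<theta>(3)[of i k] unfolding \<psi>_def by simp
  qed
  show thesis
  proof (rule that)
    show "\<psi> 0 = id" by (simp add: \<psi>_def)
    show "agree i k (\<psi> i k)" for i k using \<theta>(1) unfolding \<psi>_def by simp
    have "prod_decode 0 = (0, 0)" by (simp add: prod_decode_def prod_decode_aux.simps)
    then show "side (\<psi> i k) k = i" for i k using \<theta>(2) unfolding \<psi>_def by (simp add: side_def)
    show "orb k (\<psi> i k)" for i k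
    proof -
      obtain g where "g \<in> G" "eventually (\<lambda>w. \<psi> i w = g w) (nhds k)" using loc by blast
      then show ?thesis using eventually_self[of "\<lambda>w. \<psi> i w = g w" k] by simp
    qed
    show "continuous_on UNIV (\<psi> i)" for i
      unfolding continuous_iff_agree
    proof (intro allI)
      fix k n
      obtain g where g: "g \<in> G" "eventually (\<lambda>w. \<psi> i w = g w) (nhds k)" using loc by blast
      have eq: "\<psi> i k = g k" using eventually_self[OF g(2)] .
      show "eventually (\<lambda>w. agree n (\<psi> i k) (\<psi> i w)) (nhds k)"
        using eventually_G[OF g(1) eventually_agree[of n "g k"]] g(2)
        by eventually_elim (simp add: eq)
    qed
  qed
qed

text \<open>The maps \<open>\<theta> i\<close> run through the pieces of the orbit of
  \<open>k\<close> and one further piece, the orbit of \<open>\<sigma> k\<close>, which by sparsity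
  misses \<open>C\<close> and is not cut. A homeomorphism preserving \<open>cut\<close> and
  extending \<open>\<psi> i k \<mapsto> \<theta> i k\<close> therefore carries the orbit of
  \<open>k\<close> onto the union of both orbits.\<close>

lemma absorb:
  assumes \<sigma>: "continuous_on C \<sigma>" "inj_on \<sigma> C" and K: "sparse_set (C \<union> \<sigma> ` C)" "C \<inter> \<sigma> ` C = {}"
  obtains f f' where "homeomorphism UNIV UNIV f f'"
    "\<And>x y. orb x y \<longleftrightarrow> glued C \<sigma> (f x) (f y)"
proof -
  interpret HH: minimal_ample_system H by (rule minimal_ample_H)
  have HHorb: "HH.orb x y \<longleftrightarrow> cut x y" for x y unfolding HH.orb_def by (rule H_orbits)
  obtain \<psi> :: "nat \<Rightarrow> cantor \<Rightarrow> cantor" where \<psi>0: "\<psi> 0 = id"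
    and \<psi>ag: "\<And>i k. agree i k (\<psi> i k)" and \<psi>side: "\<And>i k. side (\<psi> i k) k = i"
    and \<psi>orb: "\<And>i k. orb k (\<psi> i k)" and \<psi>cont: "\<And>i. continuous_on UNIV (\<psi> i)"
    using sections_exist by metis
  have clC: "closed C" using C by (simp add: sparse_set_def)
  have K_unique: "x = y" if "x \<in> C \<union> \<sigma> ` C" "y \<in> C \<union> \<sigma> ` C" "orb x y" for x y
    using K(1) that unfolding sparse_set_def by blast
  have sep: "\<not> orb (\<sigma> k) k'" "\<not> orb k' (\<sigma> k)" if "k \<in> C" "k' \<in> C" for k k'
    using K_unique[of "\<sigma> k" k'] K_unique[of k' "\<sigma> k"] that K(2) by blast+
  have \<psi>uniq: "k = k'" if "k \<in> C" "k' \<in> C" "orb (\<psi> i k) (\<psi> j k')" for i j k k'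
    using C_unique[OF that(1,2)] orb_trans[OF orb_trans[OF \<psi>orb that(3)] orb_sym[OF \<psi>orb]] .
  have \<psi>cut: "i = j \<and> k = k'" if "k \<in> C" "k' \<in> C" "cut (\<psi> i k) (\<psi> j k')" for i j k k'
  proof -
    have k: "k = k'" using \<psi>uniq[OF that(1,2) cut_orb[OF that(3)]] .
    have "side (\<psi> i k) k = side (\<psi> j k') k" using that(1,3) \<psi>orb unfolding cut_def by blast
    then show ?thesis using \<psi>side k by simp
  qed
  have \<psi>inj: "i = j \<and> k = k'" if "k \<in> C" "k' \<in> C" "\<psi> i k = \<psi> j k'" for i j k k'
    using \<psi>cut[OF that(1,2)] that(3) cut_refl by metis
  have closed\<psi>: "closed (\<psi> i ` D)" if "closed D" for i D
    using compact_imp_closed_cantor[OF compact_continuous_image[OF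
      continuous_on_subset[OF \<psi>cont subset_UNIV] compact_closed_cantor[OF that]]] .
  define L where "L = (\<Union>i. \<psi> i ` C)"
  have LI: "\<psi> i k \<in> L" if "k \<in> C" for i k using that unfolding L_def by blast
  have farC: "\<exists>M. \<forall>z. agree M x z \<longrightarrow> z \<notin> C" if "x \<notin> C" for x
    using closed_not_eventually[OF clC that] unfolding eventually_nhds_cantor .
  \<comment> \<open>The images of \<open>C\<close> under \<open>\<psi> j\<close> approach
    \<open>C\<close> uniformly, so near a point off \<open>C\<close> only finitely many of them
    matter, and each is closed.\<close>
  have clL: "closed L"
  proof (rule closed_cantor)
    fix x assume x: "x \<notin> L"
    have "x \<notin> C" using x LI[of x 0] \<psi>0 by auto
    then obtain M where M: "\<forall>z. agree M x z \<longrightarrow> z \<notin> C" using farC by blast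
    have "eventually (\<lambda>y. \<forall>j\<in>{..<M}. y \<notin> \<psi> j ` C) (nhds x)"
      by (intro eventually_ball_finite finite_lessThan ballI closed_not_eventually closed\<psi> clC)
        (use x in \<open>auto simp: L_def\<close>)
    with eventually_agree[of M x] show "eventually (\<lambda>y. y \<notin> L) (nhds x)"
    proof eventually_elim
      case (elim y)
      have "y \<noteq> \<psi> j k" if "k \<in> C" for j k
      proof
        assume y: "y = \<psi> j k"
        show False
        proof (cases "j < M")
          case True
          then show False using elim(2) y that by blast
        next
          case False
          have "agree M x k"
            using agree_trans[OF elim(1)] agree_sym[OF agree_mono[OF \<psi>ag[of j k]], of M] False y by simp
          then show False using M that by blast
        qed
      qed
      then show ?case unfolding L_def by blast
    qed
  qed
  \<comment> \<open>Points of \<open>L\<close> near \<open>\<psi> i k\<close> come from parameters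
    near \<open>k\<close> and from the same index, except that at \<open>i = 0\<close> arbitrarily
    large indices accumulate.\<close>
  have locL: "eventually (\<lambda>y. \<forall>j. \<forall>k'\<in>C. y = \<psi> j k' \<longrightarrow> agree N k k' \<and> (j = i \<or> i = 0 \<and> N \<le> j))
      (nhds (\<psi> i k))" if k: "k \<in> C" for i k N
  proof -
    have "\<exists>M\<ge>N. i \<noteq> 0 \<longrightarrow> (\<forall>z. agree M (\<psi> i k) z \<longrightarrow> z \<notin> C)"
    proof (cases "i = 0")
      case False
      have "\<psi> i k \<notin> C" using \<psi>inj[OF k, of "\<psi> i k" i 0] \<psi>0 False by auto
      then obtain M where "\<forall>z. agree M (\<psi> i k) z \<longrightarrow> z \<notin> C" using farC by blast
      then have "\<forall>z. agree (max M N) (\<psi> i k) z \<longrightarrow> z \<notin> C" using agree_mono[of "max M N"] by simp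
      then show ?thesis by (intro exI[of _ "max M N"]) simp
    qed auto
    then obtain M where M: "N \<le> M" "i \<noteq> 0 \<Longrightarrow> agree M (\<psi> i k) z \<Longrightarrow> z \<notin> C" for z by blast
    have clD: "closed {k' \<in> C. \<not> agree N k k'}"
    proof -
      have "{k' \<in> C. \<not> agree N k k'} = C \<inter> - {k'. agree N k k'}" by blast
      then show ?thesis using clC open_agree[of N k] by (simp add: closed_Int closed_Compl)
    qed
    have "eventually (\<lambda>y. y \<notin> \<psi> j ` {k' \<in> C. \<not> agree N k k'} \<and> (j \<noteq> i \<longrightarrow> y \<notin> \<psi> j ` C)) (nhds (\<psi> i k))" for j
    proof (rule eventually_conj)
      have "\<psi> i k \<notin> \<psi> j ` {k' \<in> C. \<not> agree N k k'}"
      proof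
        assume "\<psi> i k \<in> \<psi> j ` {k' \<in> C. \<not> agree N k k'}"
        then obtain k' where "k' \<in> C" "\<not> agree N k k'" "\<psi> i k = \<psi> j k'" by blast
        then show False using \<psi>inj[OF k, of k' i j] by simp
      qed
      then show "eventually (\<lambda>y. y \<notin> \<psi> j ` {k' \<in> C. \<not> agree N k k'}) (nhds (\<psi> i k))"
        by (rule closed_not_eventually[OF closed\<psi>[OF clD]])
      show "eventually (\<lambda>y. j \<noteq> i \<longrightarrow> y \<notin> \<psi> j ` C) (nhds (\<psi> i k))"
      proof (cases "j = i")
        case False
        have "\<psi> i k \<notin> \<psi> j ` C" using \<psi>inj[OF k] False by blast
        then have "eventually (\<lambda>y. y \<notin> \<psi> j ` C) (nhds (\<psi> i k))"
          by (rule closed_not_eventually[OF closed\<psi>[OF clC]])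
        then show ?thesis by (rule eventually_mono) simp
      qed simp
    qed
    then have "eventually (\<lambda>y. \<forall>j\<in>{..<M}. y \<notin> \<psi> j ` {k' \<in> C. \<not> agree N k k'} \<and>
        (j \<noteq> i \<longrightarrow> y \<notin> \<psi> j ` C)) (nhds (\<psi> i k))"
      by (intro eventually_ball_finite finite_lessThan ballI)
    with eventually_agree[of M "\<psi> i k"] show ?thesis
    proof eventually_elim
      case (elim y)
      show ?case
      proof (intro allI ballI impI)
        fix j k' assume k': "k' \<in> C" and y: "y = \<psi> j k'"
        show "agree N k k' \<and> (j = i \<or> i = 0 \<and> N \<le> j)"
        proof (cases "j < M")
          case True
          then have "y \<notin> \<psi> j ` {k' \<in> C. \<not> agree N k k'}" "j \<noteq> i \<longrightarrow> y \<notin> \<psi> j ` C"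
            using elim(2) by blast+
          then show ?thesis using k' y by blast
        next
          case False
          have "agree M (\<psi> i k) k'"
            using agree_trans[OF elim(1)] agree_sym[OF agree_mono[OF \<psi>ag[of j k']], of M] False y by simp
          moreover from this have "i = 0" using M(2) k' by blast
          ultimately show ?thesis using \<psi>0 agree_mono[of M k k' N] M(1) False by simp
        qed
      qed
    qed
  qed
  \<comment> \<open>truncated subtraction: \<open>\<theta> 0 = \<psi> 0\<close>\<close>
  define \<theta> where "\<theta> i = (if i = 1 then \<sigma> else \<psi> (i - 1))" for i
  have \<theta>cut: "i = j \<and> k = k'" if k: "k \<in> C" "k' \<in> C" and c: "cut (\<theta> i k) (\<theta> j k')" for i j k k'
  proof -
    have no: "\<not> orb (\<sigma> u) (\<psi> m v)" "\<not> orb (\<psi> m v) (\<sigma> u)" if "u \<in> C" "v \<in> C" for u v m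
      using sep[OF that] orb_trans[OF _ orb_sym[OF \<psi>orb[of v m]]] orb_trans[OF \<psi>orb[of v m]] by blast+
    have o: "orb (\<theta> i k) (\<theta> j k')" using cut_orb[OF c] .
    consider "i = 1" "j = 1" | "i = 1" "j \<noteq> 1" | "i \<noteq> 1" "j = 1" | "i \<noteq> 1" "j \<noteq> 1" by blast
    then show ?thesis
    proof cases
      case 1
      then have "\<sigma> k = \<sigma> k'" using K_unique[of "\<sigma> k" "\<sigma> k'"] o k by (simp add: \<theta>_def)
      then show ?thesis using 1 inj_onD[OF \<sigma>(2)] k by simp
    next
      case 2
      then show ?thesis using no k o by (simp add: \<theta>_def)
    next
      case 3
      then show ?thesis using no k o by (simp add: \<theta>_def)
    next
      case 4
      then have "cut (\<psi> (i - 1) k) (\<psi> (j - 1) k')" using c by (simp add: \<theta>_def)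
      \<comment> \<open>Truncated subtraction of \<open>1\<close> identifies only \<open>0\<close>
        and \<open>1\<close>, and \<open>1\<close> is excluded in this case.\<close>
      from \<psi>cut[OF k this] show ?thesis using 4 by (cases i; cases j) auto
    qed
  qed
  have \<theta>orb: "orb k (\<theta> i k) \<or> orb (\<sigma> k) (\<theta> i k)" for i k
    using \<psi>orb by (simp add: \<theta>_def)
  define h where "h x = (SOME y. \<exists>i. \<exists>k\<in>C. x = \<psi> i k \<and> y = \<theta> i k)" for x
  have h: "h (\<psi> i k) = \<theta> i k" if k: "k \<in> C" for i k
    unfolding h_def
  proof (rule some_equality)
    show "\<exists>j. \<exists>k'\<in>C. \<psi> i k = \<psi> j k' \<and> \<theta> i k = \<theta> j k'" using k by blast
    show "y = \<theta> i k" if "\<exists>j. \<exists>k'\<in>C. \<psi> i k = \<psi> j k' \<and> y = \<theta> j k'" for y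
      using that \<psi>inj[OF k] by blast
  qed
  have conth: "continuous_on L h"
    unfolding continuous_on_iff_agree
  proof (intro ballI allI)
    fix x n assume "x \<in> L"
    then obtain i k where x: "x = \<psi> i k" and k: "k \<in> C" unfolding L_def by blast
    have "continuous_on C (\<theta> i)"
      unfolding \<theta>_def using \<sigma>(1) continuous_on_subset[OF \<psi>cont subset_UNIV] by simp
    then have "eventually (\<lambda>k'. k' \<in> C \<longrightarrow> agree n (\<theta> i k) (\<theta> i k')) (nhds k)"
      using k unfolding continuous_on_iff_agree by blast
    then obtain N0 where N0: "\<And>k'. agree N0 k k' \<Longrightarrow> k' \<in> C \<Longrightarrow> agree n (\<theta> i k) (\<theta> i k')"
      unfolding eventually_nhds_cantor by blast
    \<comment> \<open>For \<open>j \<ge> n + 2\<close> the index is not \<open>1\<close>, so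
      \<open>\<theta> j\<close> is \<open>\<psi> (j - 1)\<close>, and \<open>j - 1 \<ge> n\<close>
      keeps it close to the identity. This is continuity at the accumulation points
      \<open>i = 0\<close>.\<close>
    define N where "N = max N0 (n + 2)"
    have "eventually (\<lambda>y. y \<in> L \<longrightarrow> agree n (h (\<psi> i k)) (h y)) (nhds (\<psi> i k))"
      using locL[OF k, of N i]
    proof (rule eventually_mono, intro impI)
      fix y
      assume *: "\<forall>j. \<forall>k'\<in>C. y = \<psi> j k' \<longrightarrow> agree N k k' \<and> (j = i \<or> i = 0 \<and> N \<le> j)"
      assume "y \<in> L"
      then obtain j k' where y: "y = \<psi> j k'" and k': "k' \<in> C" unfolding L_def by blast
      have ag: "agree N k k'" and j: "j = i \<or> i = 0 \<and> N \<le> j" using * y k' by blast+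
      have "agree n (\<theta> i k) (\<theta> j k')"
      proof (cases "j = i")
        case True
        then show ?thesis using N0[OF agree_mono[OF ag] k'] by (simp add: N_def)
      next
        case False
        then have i0: "i = 0" and jN: "N \<le> j" using j by auto
        have "\<theta> i k = k" "\<theta> j k' = \<psi> (j - 1) k'" using i0 jN \<psi>0 by (simp_all add: \<theta>_def N_def)
        moreover have "agree n k k'" using agree_mono[OF ag, of n] by (simp add: N_def)
        moreover have "agree n k' (\<psi> (j - 1) k')"
        proof (rule agree_mono[OF \<psi>ag])
          have "n + 2 \<le> j" using jN by (simp add: N_def)
          then show "n \<le> j - 1" by arith
        qed
        ultimately show ?thesis using agree_trans by simp
      qed
      then show "agree n (h (\<psi> i k)) (h y)" using h k k' y by simp
    qed
    then show "eventually (\<lambda>y. y \<in> L \<longrightarrow> agree n (h x) (h y)) (nhds x)" unfolding x .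
  qed
  have inLD: "\<exists>i. \<exists>k\<in>C. x = \<psi> i k" if "x \<in> L" for x using that unfolding L_def by blast
  have injh: "inj_on h L"
  proof (rule inj_onI)
    fix x y assume xy: "x \<in> L" "y \<in> L" "h x = h y"
    obtain i k j k' where *: "k \<in> C" "x = \<psi> i k" "k' \<in> C" "y = \<psi> j k'" using inLD xy(1,2) by meson
    then have "cut (\<theta> i k) (\<theta> j k')" using xy(3) h by simp
    from \<theta>cut[OF *(1,3) this] show "x = y" using *(2,4) by simp
  qed
  have cL: "compact L" by (rule compact_closed_cantor[OF clL])
  have hom: "homeomorphism L (h ` L) h (inv_into L h)"
    by (rule homeomorphism_compact_cantor[OF cL conth injh])
  have sL: "HH.sparse_set L"
    unfolding HH.sparse_set_def HHorb
  proof (intro conjI ballI impI clL)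
    fix x y assume xy: "x \<in> L" "y \<in> L" "cut x y"
    obtain i k j k' where *: "k \<in> C" "x = \<psi> i k" "k' \<in> C" "y = \<psi> j k'" using inLD xy(1,2) by meson
    from \<psi>cut[OF *(1,3) xy(3)[unfolded *(2,4)]] show "x = y" using *(2,4) by simp
  qed
  have sL': "HH.sparse_set (h ` L)"
    unfolding HH.sparse_set_def HHorb
  proof (intro conjI ballI impI)
    show "closed (h ` L)"
      by (rule compact_imp_closed_cantor[OF compact_continuous_image[OF conth cL]])
    fix u v assume "u \<in> h ` L" "v \<in> h ` L" and c: "cut u v"
    then obtain x y where xy: "x \<in> L" "y \<in> L" "u = h x" "v = h y" by blast
    obtain i k j k' where *: "k \<in> C" "x = \<psi> i k" "k' \<in> C" "y = \<psi> j k'" using inLD xy(1,2) by meson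
    then have "u = \<theta> i k" "v = \<theta> j k'" using xy(3,4) h by simp_all
    with \<theta>cut[OF *(1,3), of i j] c show "u = v" by blast
  qed
  obtain f f' where f: "homeomorphism UNIV UNIV f f'" "\<And>x. x \<in> L \<Longrightarrow> f x = h x"
    "\<And>x y. cut (f x) (f y) \<longleftrightarrow> cut x y"
    using HH.extend_sparse_homeomorphism[OF hom sL sL'] unfolding HHorb by metis
  have f\<psi>: "f (\<psi> i k) = \<theta> i k" if "k \<in> C" for i k using f(2)[OF LI[OF that]] h[OF that] by simp
  have pieces: "cut (\<psi> (side x k) k) x" if k: "k \<in> C" "orb k x" for x k
    unfolding cut_def
  proof (intro conjI ballI impI)
    show "orb (\<psi> (side x k) k) x" using orb_trans[OF orb_sym[OF \<psi>orb] k(2)] .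
    fix k' assume k': "k' \<in> C" "orb k' (\<psi> (side x k) k)"
    have "k' = k" using C_unique[OF k'(1) k(1) orb_trans[OF k'(2) orb_sym[OF \<psi>orb]]] .
    then show "side (\<psi> (side x k) k) k' = side x k'" using \<psi>side by simp
  qed
  have free: "cut x y" if "orb x y" "\<And>k. k \<in> C \<Longrightarrow> \<not> orb k x" for x y
    using that unfolding cut_def by blast
  have glue1: "orb k (f x) \<or> orb (\<sigma> k) (f x)" if k: "k \<in> C" "orb k x" for k x
  proof -
    have "cut (\<theta> (side x k) k) (f x)" using f(3) pieces[OF k] f\<psi>[OF k(1)] by metis
    then show ?thesis using \<theta>orb[of k "side x k"] orb_trans cut_orb by blast
  qed
  have glue2: "orb k x" if k: "k \<in> C" and o: "orb k (f x) \<or> orb (\<sigma> k) (f x)" for k x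
  proof -
    have "\<exists>j. cut (\<theta> j k) (f x)"
      using o
    proof
      assume o: "orb k (f x)"
      define i where "i = side (f x) k"
      \<comment> \<open>The shift read backwards: piece \<open>0\<close> stays and piece
        \<open>i > 0\<close> is hit by index \<open>i + 1\<close>.\<close>
      have "\<psi> i k = \<theta> (if i = 0 then 0 else i + 1) k" by (simp add: \<theta>_def)
      then show ?thesis using pieces[OF k o] unfolding i_def by metis
    next
      assume "orb (\<sigma> k) (f x)"
      \<comment> \<open>No orbit through \<open>C\<close> contains \<open>\<sigma> k\<close>, so its
        orbit is a single piece.\<close>
      then have "cut (\<sigma> k) (f x)" using free sep(2)[OF k] by blast
      then show ?thesis by (intro exI[of _ 1]) (simp add: \<theta>_def)
    qed
    then obtain j where "cut (\<theta> j k) (f x)" ..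
    then have "cut (\<psi> j k) x" using f(3) f\<psi>[OF k] by metis
    then show ?thesis using \<psi>orb orb_trans cut_orb by blast
  qed
  show thesis
  proof (rule that[OF f(1)])
    fix x y
    show "orb x y \<longleftrightarrow> glued C \<sigma> (f x) (f y)"
      unfolding glued_def
    proof
      assume xy: "orb x y"
      show "orb (f x) (f y) \<or>
        (\<exists>k\<in>C. (orb k (f x) \<or> orb (\<sigma> k) (f x)) \<and> (orb k (f y) \<or> orb (\<sigma> k) (f y)))"
      proof (cases "\<exists>k\<in>C. orb k x")
        case True
        then obtain k where k: "k \<in> C" "orb k x" by blast
        show ?thesis using glue1[OF k] glue1[OF k(1) orb_trans[OF k(2) xy]] k(1) by blast
      next
        case False
        then have "cut x y" using free[OF xy] by blast
        then show ?thesis using f(3) cut_orb by blast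
      qed
    next
      assume "orb (f x) (f y) \<or>
        (\<exists>k\<in>C. (orb k (f x) \<or> orb (\<sigma> k) (f x)) \<and> (orb k (f y) \<or> orb (\<sigma> k) (f y)))"
      then show "orb x y"
      proof
        assume o: "orb (f x) (f y)"
        show ?thesis
        proof (cases "\<exists>k\<in>C. orb k (f x)")
          case True
          then obtain k where k: "k \<in> C" "orb k (f x)" by blast
          have "orb k x" "orb k y" using glue2[OF k(1)] k(2) orb_trans[OF k(2) o] by blast+
          then show ?thesis using orb_sym orb_trans by blast
        next
          case False
          then have "cut (f x) (f y)" using free[OF o] by blast
          then show ?thesis using f(3) cut_orb by blast
        qed
      next
        assume "\<exists>k\<in>C. (orb k (f x) \<or> orb (\<sigma> k) (f x)) \<and> (orb k (f y) \<or> orb (\<sigma> k) (f y))"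
        then obtain k where "k \<in> C" "orb k x" "orb k y" using glue2 by blast
        then show ?thesis using orb_sym orb_trans by blast
      qed
    qed
  qed
qed

end

context minimal_ample_system
begin

theorem absorption:
  assumes "closed C" and \<sigma>: "continuous_on C \<sigma>" "inj_on \<sigma> C"
    and K: "sparse_set (C \<union> \<sigma> ` C)" "C \<inter> \<sigma> ` C = {}"
  obtains f f' where "homeomorphism UNIV UNIV f f'"
    "\<And>x y. orb x y \<longleftrightarrow> glued C \<sigma> (f x) (f y)"
proof -
  obtain Gs :: "nat \<Rightarrow> (cantor \<Rightarrow> cantor) set" where Gs:
    "Gs 0 = {id}" "\<And>n. fsubgroup (Gs n)" "\<And>n. Gs n \<subseteq> Gs (Suc n)" "(\<Union>n. Gs n) = G"
    "\<And>n x z. \<exists>g\<in>Gs (Suc n). agree (Suc n) z (g x) \<and> g x \<notin> (\<lambda>s. s x) ` Gs n"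
    using filtration_exists by metis
  have sC: "sparse_set C" using assms(1) K(1) unfolding sparse_set_def by simp
  interpret filtered_system G Gs C
    by unfold_locales (fact Gs sC)+
  show thesis using absorb[OF \<sigma> K] that by metis
qed

end

section \<open>Ample groups of homeomorphisms and the theorem\<close>

lemma homeomorphism_Homeo:
  assumes "homeomorphism UNIV UNIV f f'"
  shows "f \<in> carrier Homeo" "f' \<in> carrier Homeo" "inv\<^bsub>Homeo\<^esub> f = f'"
proof -
  show f: "f \<in> carrier Homeo" and f': "f' \<in> carrier Homeo"
    using assms homeomorphism_symD[OF assms] unfolding Homeo_def homeos_def by auto
  have "f' \<otimes>\<^bsub>Homeo\<^esub> f = \<one>\<^bsub>Homeo\<^esub>"
    using assms by (simp add: Homeo_def homeomorphism_def fun_eq_iff)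
  then show "inv\<^bsub>Homeo\<^esub> f = f'" by (rule group.inv_equality[OF group_Homeo _ f f'])
qed

lemma Homeo_D:
  assumes "f \<in> carrier Homeo"
  shows "homeomorphism UNIV UNIV f (hinv f)" "bij f" "continuous_on UNIV f" "inv\<^bsub>Homeo\<^esub> f = hinv f"
proof -
  obtain g where g: "homeomorphism UNIV UNIV f g"
    using assms unfolding Homeo_def homeos_def by auto
  then have gf: "\<And>x. g (f x) = x" "\<And>x. f (g x) = x" by (simp_all add: homeomorphism_def)
  then show b: "bij f" by (intro o_bij[of g]) (auto simp: fun_eq_iff)
  have "hinv f = g" using inv_equality[of g f] gf by simp
  then show hom: "homeomorphism UNIV UNIV f (hinv f)" using g by simp
  then show "continuous_on UNIV f" by (simp add: homeomorphism_def)
  show "inv\<^bsub>Homeo\<^esub> f = hinv f" by (rule homeomorphism_Homeo(3)[OF hom])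
qed

text \<open>The main point is fullness. A bijection that is locally in \<open>\<Gamma>\<close> is
  continuous, hence a homeomorphism by compactness; compactness again leaves finitely many members
  of an enumeration to agree with, as \<open>full_group\<close> demands.\<close>

lemma minimal_ample_systemI:
  assumes "ample \<Gamma>" and min: "minimal_action \<Gamma>"
  shows "minimal_ample_system \<Gamma>"
proof
  have sub: "subgroup \<Gamma> Homeo" and fullG: "\<And>g A. g \<in> carrier Homeo \<Longrightarrow> A \<subseteq> \<Gamma> \<Longrightarrow> finite A \<Longrightarrow>
      (\<And>x. \<exists>\<gamma>\<in>A. g x = \<gamma> x) \<Longrightarrow> g \<in> \<Gamma>"
    and c\<Gamma>: "countable \<Gamma>" and lf: "locally_finite_group \<Gamma>"
    and fixo: "\<And>\<gamma>. \<gamma> \<in> \<Gamma> \<Longrightarrow> open {x. \<gamma> x = x}"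
    using assms(1) unfolding ample_def full_group_def by blast+
  note car = subgroup.mem_carrier[OF sub]
  show "id \<in> \<Gamma>" using subgroup.one_closed[OF sub] by (simp add: Homeo_def)
  show "f \<circ> g \<in> \<Gamma>" if "f \<in> \<Gamma>" "g \<in> \<Gamma>" for f g
    using subgroup.m_closed[OF sub that] by (simp add: Homeo_def)
  show "hinv g \<in> \<Gamma>" if "g \<in> \<Gamma>" for g
    using subgroup.m_inv_closed[OF sub that] Homeo_D(4)[OF car[OF that]] by simp
  show "bij g" "continuous_on UNIV g" if "g \<in> \<Gamma>" for g using Homeo_D[OF car[OF that]] by blast+
  show "countable \<Gamma>" by (rule c\<Gamma>)
  show "eventually (\<lambda>y. g y = y) (nhds x)" if "g \<in> \<Gamma>" "g x = x" for g x
    unfolding eventually_nhds using fixo[OF that(1)] that(2) by (intro exI[of _ "{x. g x = x}"]) simp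
  show "\<exists>S. fsubgroup S \<and> A \<subseteq> S \<and> S \<subseteq> \<Gamma>" if A: "finite A" "A \<subseteq> \<Gamma>" for A
  proof (intro exI[of _ "generate Homeo A"] conjI)
    have AC: "A \<subseteq> carrier Homeo" using A(2) car by blast
    have gs: "subgroup (generate Homeo A) Homeo" by (rule group.generate_is_subgroup[OF group_Homeo AC])
    show "A \<subseteq> generate Homeo A" by (rule subsetI) (rule generate.incl)
    show "generate Homeo A \<subseteq> \<Gamma>" by (rule group.generate_subgroup_incl[OF group_Homeo A(2) sub])
    have "finite (generate Homeo A)" using lf A unfolding locally_finite_group_def by blast
    moreover have "id \<in> generate Homeo A" using subgroup.one_closed[OF gs] by (simp add: Homeo_def)
    moreover have "f \<circ> g \<in> generate Homeo A" if "f \<in> generate Homeo A" "g \<in> generate Homeo A" for f g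
      using subgroup.m_closed[OF gs that] by (simp add: Homeo_def)
    moreover have "hinv g \<in> generate Homeo A" if "g \<in> generate Homeo A" for g
      using subgroup.m_inv_closed[OF gs that] Homeo_D(4)[OF subgroup.mem_carrier[OF gs that]] by simp
    ultimately show "fsubgroup (generate Homeo A)" unfolding fsubgroup_def by blast
  qed
  show "f \<in> \<Gamma>" if f: "bij f" "\<And>x. \<exists>g\<in>\<Gamma>. eventually (\<lambda>y. f y = g y) (nhds x)" for f
  proof -
    have contf: "continuous_on UNIV f"
      unfolding continuous_iff_agree
    proof (intro allI)
      fix x n
      obtain g where g: "g \<in> \<Gamma>" "eventually (\<lambda>y. f y = g y) (nhds x)" using f(2) by blast
      have eq: "f x = g x" using eventually_self[OF g(2)] .
      show "eventually (\<lambda>y. agree n (f x) (f y)) (nhds x)"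
        using eventually_comp[OF Homeo_D(3)[OF car[OF g(1)]], of "agree n (g x)" x, OF eventually_agree] g(2)
        by eventually_elim (simp add: eq)
    qed
    have "homeomorphism UNIV (f ` UNIV) f (hinv f)"
      by (rule homeomorphism_compact_cantor[OF compact_cantor contf bij_is_inj[OF f(1)]])
    then have fH: "f \<in> carrier Homeo"
      using homeomorphism_Homeo(1) f(1) by (simp add: bij_def)
    define e where "e = from_nat_into \<Gamma>"
    have ne: "\<Gamma> \<noteq> {}" using \<open>id \<in> \<Gamma>\<close> by blast
    have "\<exists>n. \<forall>x\<in>UNIV. \<exists>i<n. f x = e i x"
    proof (rule compact_uniform[OF compact_cantor])
      fix x
      obtain g where g: "g \<in> \<Gamma>" "eventually (\<lambda>y. f y = g y) (nhds x)" using f(2) by blast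
      obtain i where "g = e i" using from_nat_into_surj[OF c\<Gamma> g(1)] unfolding e_def by metis
      then have "eventually (\<lambda>y. \<exists>j<Suc i. f y = e j y) (nhds x)"
        using g(2) by (elim eventually_mono) blast
      then show "\<exists>n. eventually (\<lambda>y. \<exists>j<n. f y = e j y) (nhds x)" ..
    next
      fix m n :: nat and x
      assume "m \<le> n" "\<exists>i<m. f x = e i x"
      then show "\<exists>i<n. f x = e i x" using less_le_trans by blast
    qed
    then obtain n where n: "\<forall>x\<in>UNIV. \<exists>i<n. f x = e i x" ..
    show ?thesis
    proof (rule fullG[OF fH])
      show "e ` {..<n} \<subseteq> \<Gamma>" unfolding e_def using from_nat_into[OF ne] by blast
      show "\<exists>\<gamma>\<in>e ` {..<n}. f x = \<gamma> x" for x using bspec[OF n, of x] by auto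
    qed simp
  qed
  show "\<exists>g\<in>\<Gamma>. agree n z (g x)" for n z x
  proof -
    have "z \<in> closure ((\<lambda>\<gamma>. \<gamma> x) ` \<Gamma>)" using min unfolding minimal_action_def by simp
    then have "{y. agree n z y} \<inter> closure ((\<lambda>\<gamma>. \<gamma> x) ` \<Gamma>) \<noteq> {}" using agree_refl by blast
    then have "{y. agree n z y} \<inter> (\<lambda>\<gamma>. \<gamma> x) ` \<Gamma> \<noteq> {}"
      unfolding open_Int_closure_eq_empty[OF open_agree] .
    then show ?thesis by blast
  qed
qed

theorem theorem6p5:
  fixes \<Gamma> :: "(cantor \<Rightarrow> cantor) set"
    and K K\<^sub>1 :: "cantor set"
    and \<sigma> :: "cantor \<Rightarrow> cantor"
  assumes "ample \<Gamma>"
    and "minimal_action \<Gamma>"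
    and "closed K\<^sub>1"
    and "K = K\<^sub>1 \<union> \<sigma> ` K\<^sub>1"
    and "K\<^sub>1 \<inter> \<sigma> ` K\<^sub>1 = {}"
    and "\<sigma> \<in> homeos K"
    and "\<forall>k\<in>K. \<sigma> (\<sigma> k) = k"
    and "sparse \<Gamma> K"
  shows "(\<exists>f\<in>carrier Homeo.
            induces ((\<lambda>\<gamma>. f \<circ> \<gamma> \<circ> inv\<^bsub>Homeo\<^esub> f) ` \<Gamma>) (glued_rel \<Gamma> K \<sigma>))
         \<and> rel_isomorphic (glued_rel \<Gamma> K \<sigma>) (orbit_rel \<Gamma>)"
proof -
  interpret minimal_ample_system \<Gamma> by (rule minimal_ample_systemI[OF assms(1,2)])
  have cont: "continuous_on K\<^sub>1 \<sigma>"
  proof -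
    have "continuous_on K \<sigma>" using assms(6) by (auto simp: homeos_def homeomorphism_def)
    then show ?thesis by (rule continuous_on_subset) (simp add: assms(4))
  qed
  have inj: "inj_on \<sigma> K\<^sub>1"
    using assms(4,7) by (metis UnI1 inj_onI)
  have sp: "sparse_set (K\<^sub>1 \<union> \<sigma> ` K\<^sub>1)"
    unfolding sparse_set_def
  proof (intro conjI ballI impI)
    show "closed (K\<^sub>1 \<union> \<sigma> ` K\<^sub>1)" using assms(4,8) by (simp add: sparse_def)
    fix x y assume xy: "x \<in> K\<^sub>1 \<union> \<sigma> ` K\<^sub>1" "y \<in> K\<^sub>1 \<union> \<sigma> ` K\<^sub>1" "orb x y"
    have sK: "\<forall>x. \<forall>y \<in> K \<inter> (\<lambda>\<gamma>. \<gamma> x) ` \<Gamma>. \<forall>z \<in> K \<inter> (\<lambda>\<gamma>. \<gamma> x) ` \<Gamma>. y = z"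
      using assms(8) unfolding sparse_def by (rule conjunct2)
    have 1: "x \<in> K \<inter> (\<lambda>\<gamma>. \<gamma> x) ` \<Gamma>" using xy(1) assms(4) id_in by (auto intro: image_eqI[of _ _ id])
    obtain g where "g \<in> \<Gamma>" "g x = y" using xy(3) unfolding orb_def by blast
    then have 2: "y \<in> K \<inter> (\<lambda>\<gamma>. \<gamma> x) ` \<Gamma>" using xy(2) assms(4) by blast
    show "x = y" using bspec[OF bspec[OF spec[OF sK] 1] 2] .
  qed
  obtain f f' where hom: "homeomorphism UNIV UNIV f f'"
    and glue: "\<And>x y. orb x y \<longleftrightarrow> glued K\<^sub>1 \<sigma> (f x) (f y)"
    using absorption[OF assms(3) cont inj sp assms(5)] by metis
  have f: "f \<in> carrier Homeo" "f' \<in> carrier Homeo" "inv\<^bsub>Homeo\<^esub> f = f'"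
    using homeomorphism_Homeo[OF hom] by blast+
  have ff': "f (f' x) = x" "f' (f x) = x" for x using hom by (simp_all add: homeomorphism_def)
  \<comment> \<open>The image of the orbit relation under \<open>f\<close>: in this form an
    equivalence relation by construction and induced by the conjugated group, while
    \<open>glue\<close> gives the explicit form that is compared with
    \<open>glued_rel\<close>.\<close>
  define Q where "Q = {(u, v). orb (f' u) (f' v)}"
  have Q: "(u, v) \<in> Q \<longleftrightarrow> orb u v \<or>
      (\<exists>k\<in>K\<^sub>1. (orb k u \<or> orb (\<sigma> k) u) \<and> (orb k v \<or> orb (\<sigma> k) v))" for u v
    unfolding Q_def using glue[of "f' u" "f' v"] ff' by (simp add: glued_def)
  have orbit: "orbit_rel \<Gamma> = {(u, v). orb u v}" unfolding orbit_rel_def orb_def by simp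
  have "glued_rel \<Gamma> K \<sigma> = Q"
  proof
    have "equiv UNIV Q"
      unfolding Q_def
      by (intro equivI refl_onI symI transI) (auto intro: orb_sym orb_trans)
    moreover have "orbit_rel \<Gamma> \<subseteq> Q" unfolding orbit using Q by auto
    moreover have "(k, \<sigma> k) \<in> Q" if k: "k \<in> K" for k
    proof (cases "k \<in> K\<^sub>1")
      case True
      then show ?thesis using Q orb_refl by blast
    next
      case False
      then obtain c where c: "c \<in> K\<^sub>1" "k = \<sigma> c" using k assms(4) by blast
      then have "\<sigma> k = c" using assms(4,7) by simp
      then show ?thesis unfolding Q using c by (intro disjI2 bexI[of _ c]) simp_all
    qed
    ultimately show "glued_rel \<Gamma> K \<sigma> \<subseteq> Q" unfolding glued_rel_def by blast
    show "Q \<subseteq> glued_rel \<Gamma> K \<sigma>"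
      unfolding glued_rel_def
    proof (intro Inter_greatest)
      fix E assume "E \<in> {E. equiv UNIV E \<and> orbit_rel \<Gamma> \<subseteq> E \<and> (\<forall>k\<in>K. (k, \<sigma> k) \<in> E)}"
      then have E: "sym E" "trans E" "\<And>u v. orb u v \<Longrightarrow> (u, v) \<in> E" "\<And>k. k \<in> K\<^sub>1 \<Longrightarrow> (k, \<sigma> k) \<in> E"
        using assms(4) unfolding orbit equiv_def by auto
      have kE: "(k, u) \<in> E" if "k \<in> K\<^sub>1" "orb k u \<or> orb (\<sigma> k) u" for k u
        using that E(3,4) transD[OF E(2)] by blast
      show "Q \<subseteq> E"
      proof (rule subrelI)
        fix u v assume "(u, v) \<in> Q"
        then consider "orb u v" | k where "k \<in> K\<^sub>1" "orb k u \<or> orb (\<sigma> k) u" "orb k v \<or> orb (\<sigma> k) v"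
          using Q by blast
        then show "(u, v) \<in> E"
        proof cases
          case 1
          then show ?thesis by (rule E(3))
        next
          case 2
          then show ?thesis using kE symD[OF E(1)] transD[OF E(2)] by meson
        qed
      qed
    qed
  qed
  moreover have "subgroup ((\<lambda>\<gamma>. f \<circ> \<gamma> \<circ> f') ` \<Gamma>) Homeo"
  proof (rule group.subgroupI[OF group_Homeo])
    have conj: "homeomorphism UNIV UNIV (f \<circ> \<gamma> \<circ> f') (f \<circ> hinv \<gamma> \<circ> f')" if "\<gamma> \<in> \<Gamma>" for \<gamma>
    proof -
      have "subgroup \<Gamma> Homeo" using assms(1) by (simp add: ample_def full_group_def)
      then have "homeomorphism UNIV UNIV \<gamma> (hinv \<gamma>)"
        using Homeo_D(1)[OF subgroup.mem_carrier[OF _ that]] by simp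
      from homeomorphism_compose[OF homeomorphism_compose[OF homeomorphism_symD[OF hom] this] hom]
      show ?thesis by (simp add: comp_assoc)
    qed
    show "(\<lambda>\<gamma>. f \<circ> \<gamma> \<circ> f') ` \<Gamma> \<subseteq> carrier Homeo" using homeomorphism_Homeo(1)[OF conj] by blast
    show "(\<lambda>\<gamma>. f \<circ> \<gamma> \<circ> f') ` \<Gamma> \<noteq> {}" using id_in by blast
    fix a assume "a \<in> (\<lambda>\<gamma>. f \<circ> \<gamma> \<circ> f') ` \<Gamma>"
    then obtain \<gamma> where \<gamma>: "\<gamma> \<in> \<Gamma>" "a = f \<circ> \<gamma> \<circ> f'" by blast
    show "inv\<^bsub>Homeo\<^esub> a \<in> (\<lambda>\<gamma>. f \<circ> \<gamma> \<circ> f') ` \<Gamma>"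
      unfolding \<gamma>(2) homeomorphism_Homeo(3)[OF conj[OF \<gamma>(1)]] using inv_in[OF \<gamma>(1)] by blast
    fix b assume "b \<in> (\<lambda>\<gamma>. f \<circ> \<gamma> \<circ> f') ` \<Gamma>"
    then obtain \<delta> where \<delta>: "\<delta> \<in> \<Gamma>" "b = f \<circ> \<delta> \<circ> f'" by blast
    have "a \<circ> b = f \<circ> (\<gamma> \<circ> \<delta>) \<circ> f'" by (rule ext) (simp add: \<gamma>(2) \<delta>(2) ff')
    then show "a \<otimes>\<^bsub>Homeo\<^esub> b \<in> (\<lambda>\<gamma>. f \<circ> \<gamma> \<circ> f') ` \<Gamma>"
      using comp_in[OF \<gamma>(1) \<delta>(1)] by (simp add: Homeo_def)
  qed
  moreover have "Q = orbit_rel ((\<lambda>\<gamma>. f \<circ> \<gamma> \<circ> f') ` \<Gamma>)"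
  proof -
    have "orb (f' u) (f' v) \<longleftrightarrow> (\<exists>\<gamma>\<in>\<Gamma>. f (\<gamma> (f' u)) = v)" for u v
      unfolding orb_def using ff' by metis
    then show ?thesis unfolding Q_def orbit_rel_def by auto
  qed
  ultimately have "induces ((\<lambda>\<gamma>. f \<circ> \<gamma> \<circ> inv\<^bsub>Homeo\<^esub> f) ` \<Gamma>) (glued_rel \<Gamma> K \<sigma>)"
    unfolding induces_def f(3) by simp
  moreover have "rel_isomorphic (glued_rel \<Gamma> K \<sigma>) (orbit_rel \<Gamma>)"
    unfolding rel_isomorphic_def \<open>glued_rel \<Gamma> K \<sigma> = Q\<close> orbit
    using f(2) by (intro bexI[of _ f']) (simp_all add: Q_def)
  ultimately show ?thesis using f(1) by blast
qed

end
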